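(* Let $(X,\|\cdot\|)$ be a real or complex Banach space admitting a projectional generator $\langle D,\Phi\rangle$, where $D\subset X^*$ is $r$-norming for some $r\ge 1$. Then there exists a family $\mathcal{W}\subset \mathcal{S}_{\square}(X\times D)$, rich in $X\times D$, such that for every $\gamma:=V\times Y\in\mathcal{W}$ there is a projection $Q_\gamma:X\to X$ with $\|Q_\gamma\|\le r$, $Q_\gamma X=V$, $Q_\gamma^{-1}(0)=Y_\perp$, and $Q_\gamma^*X^*=\overline{Y}^{\,w^*}$; and hence $(Q_\gamma:\gamma\in\mathcal{W})$, with $\mathcal{W}$ ordered by inclusion, is an $r$-projectional skeleton on $(X,\|\cdot\|)$ with $\bigcup_{\gamma\in\mathcal{W}}Q_\gamma^*X^*\supset D$.
   Context: Linear subspaces and linear maps are over the scalar field ($\mathbb{R}$ or $\mathbb{C}$) of $X$. $B_{X^*}$ is the closed unit ball of $X^*$; $\overline{A}$ is norm closure and $\overline{A}^{\,w^*}$ is weak$^*$ closure in $X^*$. For $Y\subset X^*$, $Y_\perp=\{x\in X: y(x)=0\ \forall y\in Y\}$; for $V\subset X$, $V^\perp=\{x^*\in X^*: x^*(v)=0\ \forall v\in V\}$. A projection on $X$ is a bounded linear operator $P:X\to X$ with $P\circ P=P$. For $r\ge1$, a set $D\subset X^*$ is $r$-norming if $\|x\|\le r\cdot\sup\{|x^*(x)|: x^*\in D\cap B_{X^*}\}$ for every $x\in X$; it is norming if it is $r$-norming for some $r\ge 1$. $[M]^{\le\omega}$ is the family of at most countable subsets of $M$. A projectional generator in $X$ is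 a couple $\langle D,\Phi\rangle$ such that $D$ is a norming closed linear subspace of $X^*$ and $\Phi:D\to[X]^{\le\omega}$ is a mapping such that for every $E\in[D]^{\le\omega}$ with $\overline{E}$ linear, $\Phi(E)^\perp\cap\overline{E}^{\,w^*}=\{0\}$, where $\Phi(E)=\bigcup_{e\in E}\Phi(e)$. For a Banach space $X$, $\mathcal{S}(X)$ is the family of all closed separable linear subspaces of $X$. A family $\mathcal{R}\subset\mathcal{S}(X)$ is rich in $X$ if (i) for every $V\in\mathcal{S}(X)$ there is $V'\in\mathcal{R}$ with $V'\supset V$, and (ii) whenever $V_1\subset V_2\subset\cdots$ is an increasing sequence in $\mathcal{R}$, then $\overline{\bigcup_i V_i}\in\mathcal{R}$. For Banach spaces $X,Z$ (over the same field), $\mathcal{S}_{\square}(X\times Z)\subset\mathcal{S}(X\times Z)$ is the family of all rectangles $V\times Y$ with $V\in\mathcal{S}(X)$, $Y\in\mathcal{S}(Z)$. A partially ordered set is $\sigma$-complete if every increasing sequence in it has a supremum. A projectional skeleton on $X$ is a family of projections $(P_s:s\in\Gamma)$ on $X$, indexed by an up-directed $\sigma$-complete partially ordered set $\Gamma$, such that (i) $P_sX$ is separable for every $s\in\Gamma$; (ii) $X=\bigcup_{s\in\Gamma}P_sX$; (iii) $P_t\circ P_s=P_s=P_s\circ P_t$ whenever $s\le t$ in $\Gamma$; (iv) if $s_1<s_2<\cdots$ in $\Gamma$ and $t=\sup_n s_n$, then $P_tX=\overline{\bigcup_n P_{s_n}X}$. It is an $r$-projectional skeleton if moreover $\|P_s\|\le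 r$ for all $s\in\Gamma$. *)

theory Defs
  imports "HOL-Analysis.Analysis" "HOL-Library.Lub_Glb"
begin

text \<open>
  The scalar field is a type of the following class: its types are, up to an isometric
  isomorphism of normed fields, exactly the real and the complex numbers.
\<close>

class real_or_complex = real_normed_field + banach +
  assumes real_or_complex:
    "\<exists>\<phi> :: 'a \<Rightarrow> complex.
       (\<forall>a b. \<phi> (a + b) = \<phi> a + \<phi> b) \<and> (\<forall>a b. \<phi> (a * b) = \<phi> a * \<phi> b) \<and>
       (\<forall>c a. \<phi> (c *\<^sub>R a) = c *\<^sub>R \<phi> a) \<and> (\<forall>a. cmod (\<phi> a) = norm a) \<and>
       (range \<phi> = \<real> \<or> range \<phi> = UNIV)"

instance real :: real_or_complex
proof
  show "\<exists>\<phi> :: real \<Rightarrow> complex.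
       (\<forall>a b. \<phi> (a + b) = \<phi> a + \<phi> b) \<and> (\<forall>a b. \<phi> (a * b) = \<phi> a * \<phi> b) \<and>
       (\<forall>c a. \<phi> (c *\<^sub>R a) = c *\<^sub>R \<phi> a) \<and> (\<forall>a. cmod (\<phi> a) = norm a) \<and>
       (range \<phi> = \<real> \<or> range \<phi> = UNIV)"
    by (rule exI[of _ of_real]) (auto simp: Reals_def scaleR_conv_of_real)
qed

instance complex :: real_or_complex
proof
  show "\<exists>\<phi> :: complex \<Rightarrow> complex.
       (\<forall>a b. \<phi> (a + b) = \<phi> a + \<phi> b) \<and> (\<forall>a b. \<phi> (a * b) = \<phi> a * \<phi> b) \<and>
       (\<forall>c a. \<phi> (c *\<^sub>R a) = c *\<^sub>R \<phi> a) \<and> (\<forall>a. cmod (\<phi> a) = norm a) \<and>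
       (range \<phi> = \<real> \<or> range \<phi> = UNIV)"
    by (rule exI[of _ "\<lambda>z. z"]) auto
qed

text \<open>
  A Banach space over the field \<open>'k\<close>: the type class \<^class>\<open>banach\<close> provides the norm and the
  underlying real Banach space, the parameter \<open>smul\<close> the multiplication by scalars from \<open>'k\<close>.
\<close>

locale scaled_banach = vector_space smul
  for smul :: "'k::real_or_complex \<Rightarrow> 'a::banach \<Rightarrow> 'a" +
  assumes norm_scale: "norm (smul c x) = norm c * norm x"
    and scale_of_real: "smul (of_real r) x = r *\<^sub>R x"

lemma scaled_banach_real: "scaled_banach ((*\<^sub>R) :: real \<Rightarrow> 'a::banach \<Rightarrow> 'a)"
  by unfold_locales (auto simp: algebra_simps)

lemma scaled_banach_field: "scaled_banach ((*) :: 'k::real_or_complex \<Rightarrow> 'k \<Rightarrow> 'k)"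
  by unfold_locales (auto simp: algebra_simps norm_mult scaleR_conv_of_real)


text \<open>
  The type \<open>'a \<Rightarrow>\<^sub>L 'k\<close> consists of all bounded real-linear maps, with the operator norm;
  \<open>dual smul\<close> is its closed subset of \<open>'k\<close>-linear ones.
\<close>

definition dual :: "('k::real_or_complex \<Rightarrow> 'a::banach \<Rightarrow> 'a) \<Rightarrow> ('a \<Rightarrow>\<^sub>L 'k) set" where
  "dual smul = {f. Vector_Spaces.linear smul (*) (blinfun_apply f)}"

definition dual_scale :: "'k::real_or_complex \<Rightarrow> ('a::banach \<Rightarrow>\<^sub>L 'k) \<Rightarrow> ('a \<Rightarrow>\<^sub>L 'k)" where
  "dual_scale c f = blinfun_mult_right c o\<^sub>L f"

lemma dual_scale_apply [simp]: "blinfun_apply (dual_scale c f) x = c * blinfun_apply f x"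
  by (simp add: dual_scale_def)

lemma scaled_banach_dual_scale:
  "scaled_banach (dual_scale :: 'k::real_or_complex \<Rightarrow> ('a::banach \<Rightarrow>\<^sub>L 'k) \<Rightarrow> ('a \<Rightarrow>\<^sub>L 'k))"
proof
  fix c :: 'k and f :: "'a \<Rightarrow>\<^sub>L 'k"
  show "norm (dual_scale c f) = norm c * norm f"
  proof (rule antisym)
    show "norm (dual_scale c f) \<le> norm c * norm f"
      by (rule norm_blinfun_bound)
        (auto simp: norm_mult mult.assoc intro!: mult_left_mono norm_blinfun)
    show "norm c * norm f \<le> norm (dual_scale c f)"
    proof (cases "c = 0")
      case False
      have "norm f \<le> norm (dual_scale c f) / norm c"
      proof (rule norm_blinfun_bound)
        fix x
        have "norm c * norm (f x) \<le> norm (dual_scale c f) * norm x"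
          using norm_blinfun[of "dual_scale c f" x] by (simp add: norm_mult)
        then show "norm (f x) \<le> norm (dual_scale c f) / norm c * norm x"
          using False by (simp add: field_simps)
      qed simp
      then show ?thesis
        using False by (simp add: field_simps)
    qed simp
  qed
qed (auto intro!: blinfun_eqI simp: algebra_simps blinfun.add_left blinfun.scaleR_left
       scaleR_conv_of_real)

lemma subspace_dual:
  fixes smul :: "'k::real_or_complex \<Rightarrow> 'a::banach \<Rightarrow> 'a"
  assumes "scaled_banach smul"
  shows "module.subspace dual_scale (dual smul)"
proof -
  interpret S: scaled_banach smul by fact
  interpret D: scaled_banach "dual_scale :: _ \<Rightarrow> ('a \<Rightarrow>\<^sub>L 'k) \<Rightarrow> _"
    by (rule scaled_banach_dual_scale)
  show ?thesis
    by (auto simp: D.subspace_def dual_def Vector_Spaces.linear_iff S.vector_space_axioms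
          vector_space_over_itself.vector_space_axioms algebra_simps blinfun.add_left)
qed

abbreviation prod_scale ::
  "('k \<Rightarrow> 'a \<Rightarrow> 'a) \<Rightarrow> 'k::real_or_complex \<Rightarrow>
     'a::banach \<times> ('a \<Rightarrow>\<^sub>L 'k) \<Rightarrow> 'a \<times> ('a \<Rightarrow>\<^sub>L 'k)" where
  "prod_scale smul \<equiv> module_prod.scale smul dual_scale"

lemma vector_space_prod_scale:
  fixes smul :: "'k::real_or_complex \<Rightarrow> 'a::banach \<Rightarrow> 'a"
  assumes "scaled_banach smul"
  shows "vector_space (prod_scale smul)"
proof -
  interpret S: scaled_banach smul by fact
  interpret D: scaled_banach "dual_scale :: _ \<Rightarrow> ('a \<Rightarrow>\<^sub>L 'k) \<Rightarrow> _"
    by (rule scaled_banach_dual_scale)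
  interpret P: vector_space_prod smul "dual_scale :: _ \<Rightarrow> ('a \<Rightarrow>\<^sub>L 'k) \<Rightarrow> _" ..
  show ?thesis by (rule P.p.vector_space_axioms)
qed

text \<open>The pullback of the product topology on \<open>'a \<Rightarrow> 'k\<close>, i.e. of pointwise convergence.\<close>

definition weak_star :: "('k::real_or_complex \<Rightarrow> 'a::banach \<Rightarrow> 'a) \<Rightarrow> ('a \<Rightarrow>\<^sub>L 'k) topology" where
  "weak_star smul = pullback_topology (dual smul) blinfun_apply euclidean"

definition annihilator ::
  "('k::real_or_complex \<Rightarrow> 'a::banach \<Rightarrow> 'a) \<Rightarrow> 'a set \<Rightarrow> ('a \<Rightarrow>\<^sub>L 'k) set" where
  "annihilator smul V = {f \<in> dual smul. \<forall>v\<in>V. blinfun_apply f v = 0}"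

definition preannihilator :: "('a::banach \<Rightarrow>\<^sub>L 'k::real_or_complex) set \<Rightarrow> 'a set" where
  "preannihilator Y = {x. \<forall>y\<in>Y. blinfun_apply y x = 0}"

text \<open>
  The supremum is that of a set of reals bounded by \<open>norm x\<close>; it is used only for \<open>D\<close>
  containing \<open>0\<close> (linear subspaces), so it is not a supremum of the empty set.
\<close>

definition r_norming ::
  "('k::real_or_complex \<Rightarrow> 'a::banach \<Rightarrow> 'a) \<Rightarrow> real \<Rightarrow> ('a \<Rightarrow>\<^sub>L 'k) set \<Rightarrow> bool" where
  "r_norming smul r D \<longleftrightarrow>
     D \<subseteq> dual smul \<and>
     (\<forall>x. norm x \<le> r * (SUP f \<in> D \<inter> cball 0 1. norm (blinfun_apply f x)))"

definition norming ::
  "('k::real_or_complex \<Rightarrow> 'a::banach \<Rightarrow> 'a) \<Rightarrow> ('a \<Rightarrow>\<^sub>L 'k) set \<Rightarrow> bool" where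
  "norming smul D \<longleftrightarrow> (\<exists>r\<ge>1. r_norming smul r D)"

definition projectional_generator ::
  "('k::real_or_complex \<Rightarrow> 'a::banach \<Rightarrow> 'a) \<Rightarrow> ('a \<Rightarrow>\<^sub>L 'k) set \<Rightarrow>
     (('a \<Rightarrow>\<^sub>L 'k) \<Rightarrow> 'a set) \<Rightarrow> bool" where
  "projectional_generator smul D \<Phi> \<longleftrightarrow>
     norming smul D \<and> closed D \<and> module.subspace dual_scale D \<and>
     (\<forall>e\<in>D. countable (\<Phi> e)) \<and>
     (\<forall>E. E \<subseteq> D \<longrightarrow> countable E \<longrightarrow> module.subspace dual_scale (closure E) \<longrightarrow>
        annihilator smul (\<Union>e\<in>E. \<Phi> e) \<inter> (weak_star smul closure_of (closure E)) = {0})"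


text \<open>
  Below, the Banach space in question is a closed linear subspace \<open>Z\<close> of a type, so that
  being closed in \<open>Z\<close> and being closed in the type coincide for subsets of \<open>Z\<close>.
\<close>

definition closed_separable_subspaces ::
  "('k::field \<Rightarrow> 'v::{ab_group_add, topological_space} \<Rightarrow> 'v) \<Rightarrow> 'v set \<Rightarrow> 'v set set" where
  "closed_separable_subspaces smul Z =
     {V. V \<subseteq> Z \<and> module.subspace smul V \<and> closed V \<and> separable_space (top_of_set V)}"

definition rich ::
  "('k::field \<Rightarrow> 'v::{ab_group_add, topological_space} \<Rightarrow> 'v) \<Rightarrow> 'v set \<Rightarrow> 'v set set \<Rightarrow> bool" where
  "rich smul Z R \<longleftrightarrow>
     R \<subseteq> closed_separable_subspaces smul Z \<and>
     (\<forall>V \<in> closed_separable_subspaces smul Z. \<exists>V'\<in>R. V \<subseteq> V') \<and>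
     (\<forall>V :: nat \<Rightarrow> 'v set. range V \<subseteq> R \<longrightarrow> incseq V \<longrightarrow> closure (\<Union>i. V i) \<in> R)"

text \<open>The family \<open>\<S>\<^sub>\<box>(X \<times> D)\<close>, where \<open>X\<close> is the whole type and \<open>D\<close> is a subspace of its dual.\<close>

definition rectangles ::
  "('k::real_or_complex \<Rightarrow> 'a::banach \<Rightarrow> 'a) \<Rightarrow> ('a \<Rightarrow>\<^sub>L 'k) set \<Rightarrow>
     ('a \<times> ('a \<Rightarrow>\<^sub>L 'k)) set set" where
  "rectangles smul D =
     {V \<times> Y | V Y. V \<in> closed_separable_subspaces smul UNIV \<and>
                   Y \<in> closed_separable_subspaces dual_scale D}"


text \<open>\<open>P\<close> is bounded by its type; \<open>linear smul smul\<close> adds linearity over the scalar field.\<close>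

definition bounded_projection ::
  "('k::real_or_complex \<Rightarrow> 'a::banach \<Rightarrow> 'a) \<Rightarrow> ('a \<Rightarrow>\<^sub>L 'a) \<Rightarrow> bool" where
  "bounded_projection smul P \<longleftrightarrow>
     Vector_Spaces.linear smul smul (blinfun_apply P) \<and> P o\<^sub>L P = P"

definition adjoint_range ::
  "('k::real_or_complex \<Rightarrow> 'a::banach \<Rightarrow> 'a) \<Rightarrow> ('a \<Rightarrow>\<^sub>L 'a) \<Rightarrow> ('a \<Rightarrow>\<^sub>L 'k) set" where
  "adjoint_range smul P = (\<lambda>f. f o\<^sub>L P) ` dual smul"

text \<open>
  The index set is a subset \<open>\<Gamma>\<close> of an ordered type, with the induced order;
  \<open>isLub \<Gamma> S t\<close> says that \<open>t\<close> is the supremum of \<open>S\<close> formed within \<open>\<Gamma>\<close>.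
\<close>

definition sigma_complete :: "'i::order set \<Rightarrow> bool" where
  "sigma_complete \<Gamma> \<longleftrightarrow>
     (\<forall>s :: nat \<Rightarrow> 'i. range s \<subseteq> \<Gamma> \<longrightarrow> incseq s \<longrightarrow> (\<exists>t. isLub \<Gamma> (range s) t))"

definition up_directed :: "'i::order set \<Rightarrow> bool" where
  "up_directed \<Gamma> \<longleftrightarrow> \<Gamma> \<noteq> {} \<and> (\<forall>s\<in>\<Gamma>. \<forall>t\<in>\<Gamma>. \<exists>u\<in>\<Gamma>. s \<le> u \<and> t \<le> u)"

definition projectional_skeleton ::
  "('k::real_or_complex \<Rightarrow> 'a::banach \<Rightarrow> 'a) \<Rightarrow> 'i::order set \<Rightarrow> ('i \<Rightarrow> 'a \<Rightarrow>\<^sub>L 'a) \<Rightarrow> bool" where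
  "projectional_skeleton smul \<Gamma> P \<longleftrightarrow>
     up_directed \<Gamma> \<and> sigma_complete \<Gamma> \<and>
     (\<forall>s\<in>\<Gamma>. bounded_projection smul (P s)) \<and>
     (\<forall>s\<in>\<Gamma>. separable_space (top_of_set (range (blinfun_apply (P s))))) \<and>
     (\<Union>s\<in>\<Gamma>. range (blinfun_apply (P s))) = UNIV \<and>
     (\<forall>s\<in>\<Gamma>. \<forall>t\<in>\<Gamma>. s \<le> t \<longrightarrow> P t o\<^sub>L P s = P s \<and> P s o\<^sub>L P t = P s) \<and>
     (\<forall>(s :: nat \<Rightarrow> 'i) t. range s \<subseteq> \<Gamma> \<longrightarrow> strict_mono s \<longrightarrow> isLub \<Gamma> (range s) t \<longrightarrow>
        range (blinfun_apply (P t)) = closure (\<Union>n. range (blinfun_apply (P (s n)))))"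

definition r_projectional_skeleton ::
  "('k::real_or_complex \<Rightarrow> 'a::banach \<Rightarrow> 'a) \<Rightarrow> real \<Rightarrow>
     'i::order set \<Rightarrow> ('i \<Rightarrow> 'a \<Rightarrow>\<^sub>L 'a) \<Rightarrow> bool" where
  "r_projectional_skeleton smul r \<Gamma> P \<longleftrightarrow>
     projectional_skeleton smul \<Gamma> P \<and> (\<forall>s\<in>\<Gamma>. norm (P s) \<le> r)"

end

theory Submission
  imports Defs
begin

text \<open>
  The family \<open>\<W>\<close> consists of the rectangles \<open>V \<times> Y\<close> such that \<open>Y\<close> is \<open>r\<close>-norming for the points of \<open>V\<close>
  and \<open>Y\<close> is the closure of a countable set \<open>E\<close> with \<open>\<Phi>(E) \<subseteq> V\<close>. Both conditions pass to closures
  of increasing unions, and a countable set can be enlarged to satisfy them by a closing-off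
  argument. The norming condition gives \<open>\<parallel>v\<parallel> \<le> r \<parallel>v + z\<parallel>\<close> for \<open>v \<in> V\<close> and \<open>z \<in> Y\<^sub>\<bottom>\<close>, so that
  \<open>V + Y\<^sub>\<bottom>\<close> is a direct sum, is closed, and has a projection onto \<open>V\<close> of norm at most \<open>r\<close>. A functional
  vanishing on \<open>V + Y\<^sub>\<bottom>\<close> lies in \<open>\<Phi>(E)\<^sup>\<bottom>\<close> and in the weak* closure of \<open>Y\<close>, hence is zero by the
  property of the projectional generator; so \<open>V + Y\<^sub>\<bottom>\<close> is the whole space by the Hahn--Banach theorem.
\<close>

subsection \<open>The Hahn--Banach theorem\<close>

text \<open>Homogeneity is demanded only as an inequality, which keeps it easy to verify for infima;
  equality follows in \<open>sublinear_scale\<close>.\<close>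

definition sublinear :: "('v::real_vector \<Rightarrow> real) \<Rightarrow> bool" where
  "sublinear p \<longleftrightarrow> (\<forall>x y. p (x + y) \<le> p x + p y) \<and> (\<forall>t x. 0 \<le> t \<longrightarrow> p (t *\<^sub>R x) \<le> t * p x)"

lemma sublinear_add: "sublinear p \<Longrightarrow> p (x + y) \<le> p x + p y"
  by (simp add: sublinear_def)

lemma sublinear_scale_le: "sublinear p \<Longrightarrow> 0 \<le> t \<Longrightarrow> p (t *\<^sub>R x) \<le> t * p x"
  by (simp add: sublinear_def)

lemma sublinear_zero: "sublinear p \<Longrightarrow> p 0 = 0"
  using sublinear_add[of p 0 0] sublinear_scale_le[of p 0 0] by simp

lemma sublinear_scale:
  assumes p: "sublinear p" and t: "0 \<le> t"
  shows "p (t *\<^sub>R x) = t * p x"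
proof (cases "t = 0")
  case False
  have "p x \<le> p (t *\<^sub>R x) / t"
    using sublinear_scale_le[OF p, of "1 / t" "t *\<^sub>R x"] t False by simp
  then show ?thesis
    using sublinear_scale_le[OF p t, of x] t False by (simp add: field_simps)
qed (simp add: sublinear_zero[OF p])

lemma sublinear_minus: "sublinear p \<Longrightarrow> - p (- x) \<le> p x"
  using sublinear_add[of p x "- x"] by (simp add: sublinear_zero)

text \<open>\<open>q\<close> is the infimum over \<open>t\<close> of the right-hand side;
  subadditivity keeps it above \<open>- p (- x)\<close>. If \<open>p\<close> is minimal, then
  \<open>q = p\<close>, and \<open>t = 1\<close> gives additivity in the direction
  \<open>y\<close>.\<close>

lemma sublinear_shift:
  fixes p :: "'v::real_vector \<Rightarrow> real"
  assumes p: "sublinear p"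
  obtains q where "sublinear q" "q \<le> p" "\<And>x t. 0 \<le> t \<Longrightarrow> q x \<le> p (x + t *\<^sub>R y) - t * p y"
proof -
  define q where "q x = (INF t\<in>{0..}. p (x + t *\<^sub>R y) - t * p y)" for x
  have bdd: "bdd_below ((\<lambda>t. p (x + t *\<^sub>R y) - t * p y) ` {0..})" for x
  proof (rule bdd_belowI2)
    fix t :: real assume "t \<in> {0..}"
    then have t: "0 \<le> t" by simp
    show "- p (- x) \<le> p (x + t *\<^sub>R y) - t * p y"
      using sublinear_add[OF p, of "x + t *\<^sub>R y" "- x"] t by (simp add: sublinear_scale[OF p])
  qed
  have le: "q x \<le> p (x + t *\<^sub>R y) - t * p y" if "0 \<le> t" for x t
    unfolding q_def by (rule cINF_lower[OF bdd]) (use that in auto)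
  have ge: "c \<le> q x" if "\<And>t. 0 \<le> t \<Longrightarrow> c \<le> p (x + t *\<^sub>R y) - t * p y" for c x
    unfolding q_def by (rule cINF_greatest) (use that in auto)
  have "q (x + x') \<le> q x + q x'" for x x'
  proof -
    \<comment> \<open>The shifts by \<open>s\<close> and by \<open>t\<close> are compared with the
      single shift by \<open>s + t\<close>. The infimum is taken over \<open>s\<close> first and
      over \<open>t\<close> afterwards.\<close>
    have "q (x + x') - (p (x' + t *\<^sub>R y) - t * p y) \<le> q x" if t: "0 \<le> t" for t
    proof (rule ge)
      fix s :: real assume s: "0 \<le> s"
      have "q (x + x') \<le> p (x + s *\<^sub>R y + (x' + t *\<^sub>R y)) - (s + t) * p y"
        using le[of "s + t" "x + x'"] s t by (simp add: algebra_simps)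
      also have "\<dots> \<le> p (x + s *\<^sub>R y) + p (x' + t *\<^sub>R y) - (s + t) * p y"
        by (simp add: sublinear_add[OF p])
      finally show "q (x + x') - (p (x' + t *\<^sub>R y) - t * p y) \<le> p (x + s *\<^sub>R y) - s * p y"
        by (simp add: algebra_simps)
    qed
    then have "q (x + x') - q x \<le> q x'"
      by (intro ge) (simp add: algebra_simps)
    then show ?thesis by simp
  qed
  moreover have "q (t *\<^sub>R x) \<le> t * q x" if t: "0 \<le> t" for t x
  proof (cases "t = 0")
    case True
    then show ?thesis using le[of 0 0] by (simp add: sublinear_zero[OF p])
  next
    case False
    have "q (t *\<^sub>R x) / t \<le> q x"
    proof (rule ge)
      fix s :: real assume s: "0 \<le> s"
      have "q (t *\<^sub>R x) \<le> p (t *\<^sub>R (x + s *\<^sub>R y)) - (t * s) * p y"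
        using le[of "t * s" "t *\<^sub>R x"] s t by (simp add: algebra_simps)
      also have "\<dots> \<le> t * p (x + s *\<^sub>R y) - (t * s) * p y"
        by (simp add: sublinear_scale_le[OF p t])
      finally show "q (t *\<^sub>R x) / t \<le> p (x + s *\<^sub>R y) - s * p y"
        using t False by (simp add: field_simps)
    qed
    then show ?thesis using t False by (simp add: field_simps)
  qed
  ultimately have "sublinear q"
    by (simp add: sublinear_def)
  moreover have "q \<le> p"
    using le[of 0] by (simp add: le_fun_def)
  ultimately show ?thesis
    using le that by blast
qed

text \<open>Zorn's lemma for the reversed pointwise order: a nonempty chain is bounded below by its
  pointwise infimum, which is finite because every member dominates
  \<open>- p (- x)\<close>.\<close>

lemma minimal_sublinear_exists:
  fixes p :: "'v::real_vector \<Rightarrow> real"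
  assumes p: "sublinear p"
  obtains u where "sublinear u" "u \<le> p" "\<And>q. sublinear q \<Longrightarrow> q \<le> u \<Longrightarrow> q = u"
proof -
  define A where "A = {q. sublinear q \<and> q \<le> p}"
  have "\<exists>m\<in>A. \<forall>a\<in>A. m \<ge> a \<longrightarrow> a = m"
  proof (rule predicate_Zorn)
    show "partial_order_on A (relation_of (\<ge>) A)"
      by (rule partial_order_on_relation_ofI) auto
  next
    fix C assume C: "C \<in> Chains (relation_of (\<ge>) A)"
    then have CA: "C \<subseteq> A" by (rule Chains_relation_of)
    have chain: "f \<le> g \<or> g \<le> f" if "f \<in> C" "g \<in> C" for f g
      using C that by (auto simp: Chains_def relation_of_def)
    show "\<exists>u\<in>A. \<forall>a\<in>C. a \<ge> u"
    proof (cases "C = {}")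
      case True
      then show ?thesis using p by (auto simp: A_def)
    next
      case False
      define q where "q x = (INF f\<in>C. f x)" for x
      have bdd: "bdd_below ((\<lambda>f. f x) ` C)" for x
      proof (rule bdd_belowI2)
        fix f assume "f \<in> C"
        then have "sublinear f" "f \<le> p" using CA by (auto simp: A_def)
        then show "- p (- x) \<le> f x"
          using sublinear_minus[of f x] le_funD[of f p "- x"] by linarith
      qed
      have le: "q x \<le> f x" if "f \<in> C" for f x
        unfolding q_def by (rule cINF_lower[OF bdd that])
      have ge: "c \<le> q x" if "\<And>f. f \<in> C \<Longrightarrow> c \<le> f x" for c x
        unfolding q_def by (rule cINF_greatest) (use False that in auto)
      have sub: "sublinear f" if "f \<in> C" for f using that CA by (auto simp: A_def)
      have "q (x + y) \<le> q x + q y" for x y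
      proof -
        have "q (x + y) \<le> f x + g y" if fg: "f \<in> C" "g \<in> C" for f g
        proof -
          \<comment> \<open>The smaller of \<open>f\<close> and \<open>g\<close> handles both values
            at once; here the chain property enters.\<close>
          obtain h where h: "h \<in> C" "h \<le> f" "h \<le> g"
            using chain[OF fg] fg by blast
          have "q (x + y) \<le> h x + h y"
            using le[OF h(1)] sublinear_add[OF sub[OF h(1)]] order_trans by blast
          then show ?thesis
            using le_funD[OF h(2), of x] le_funD[OF h(3), of y] by linarith
        qed
        then have "q (x + y) - g y \<le> q x" if "g \<in> C" for g
          using that by (intro ge) (simp add: algebra_simps)
        then have "q (x + y) - q x \<le> q y"
          by (intro ge) (simp add: algebra_simps)
        then show ?thesis by simp
      qed
      moreover have "q (t *\<^sub>R x) \<le> t * q x" if t: "0 \<le> t" for t x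
      proof (cases "t = 0")
        case True
        then show ?thesis
          using False le[of _ 0] by (force simp: sublinear_zero sub)
      next
        case nz: False
        have "q (t *\<^sub>R x) / t \<le> q x"
        proof (rule ge)
          fix f assume f: "f \<in> C"
          have "q (t *\<^sub>R x) \<le> t * f x"
            using le[OF f] sublinear_scale_le[OF sub[OF f] t] order_trans by blast
          then show "q (t *\<^sub>R x) / t \<le> f x"
            using t nz by (simp add: field_simps)
        qed
        then show ?thesis using t nz by (simp add: field_simps)
      qed
      ultimately have "sublinear q" by (simp add: sublinear_def)
      moreover obtain f where f: "f \<in> C" using False by blast
      have "q \<le> f" using le[OF f] by (rule le_funI)
      moreover have "f \<le> p" using f CA by (auto simp: A_def)
      ultimately have "q \<in> A" by (auto simp: A_def)
      then show ?thesis
        using le by (auto simp: le_fun_def)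
    qed
  qed
  then obtain u where u: "u \<in> A" and min: "\<And>q. q \<in> A \<Longrightarrow> q \<le> u \<Longrightarrow> q = u"
    by blast
  show ?thesis
  proof (rule that)
    show "sublinear u" "u \<le> p" using u by (auto simp: A_def)
    show "q = u" if "sublinear q" "q \<le> u" for q
      using u that by (intro min) (auto simp: A_def intro: order_trans)
  qed
qed

text \<open>A minimal sublinear functional is linear, since shifting it in a direction cannot decrease it.\<close>

theorem Hahn_Banach_sublinear:
  fixes p :: "'v::real_vector \<Rightarrow> real"
  assumes p: "sublinear p"
  obtains u where "linear u" "u \<le> p" "u z = p z"
proof -
  \<comment> \<open>Shifting along \<open>z\<close> first gives \<open>p' (- z) \<le> - p z\<close>,
    so that every linear functional below \<open>p'\<close> takes the value \<open>p z\<close> at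
    \<open>z\<close>.\<close>
  obtain p' where p': "sublinear p'" "p' \<le> p"
    and p'z: "\<And>x t. 0 \<le> t \<Longrightarrow> p' x \<le> p (x + t *\<^sub>R z) - t * p z"
    using sublinear_shift[OF p, of z] by blast
  obtain u where u: "sublinear u" "u \<le> p'" and min: "\<And>q. sublinear q \<Longrightarrow> q \<le> u \<Longrightarrow> q = u"
    using minimal_sublinear_exists[OF p'(1)] by blast
  have add: "u (x + y) = u x + u y" for x y
  proof -
    obtain q where "sublinear q" "q \<le> u" and q: "\<And>x t. 0 \<le> t \<Longrightarrow> q x \<le> u (x + t *\<^sub>R y) - t * u y"
      using sublinear_shift[OF u(1), of y] by blast
    then have "q = u" by (intro min)
    then show ?thesis
      using q[of 1 x] sublinear_add[OF u(1), of x y] by simp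
  qed
  have neg: "u (- x) = - u x" for x
    using add[of x "- x"] by (simp add: sublinear_zero[OF u(1)])
  \<comment> \<open>The inequality at \<open>- x\<close> is the reverse bound at \<open>x\<close>,
    since \<open>u\<close> is odd.\<close>
  have pos: "u (t *\<^sub>R x) = t * u x" if "0 \<le> t" for t x
    using sublinear_scale_le[OF u(1) that, of x] sublinear_scale_le[OF u(1) that, of "- x"]
    by (simp add: neg)
  have "u (t *\<^sub>R x) = t * u x" for t x
    using pos[of t x] pos[of "- t" x] by (cases "0 \<le> t") (auto simp: neg)
  then have "linear u"
    by (intro linearI) (simp_all add: add)
  moreover have "u \<le> p" using u(2) p'(2) by (rule order_trans)
  moreover have "- u z \<le> - p z"
    using le_funD[OF u(2), of "- z"] p'z[of 1 "- z"] by (simp add: neg sublinear_zero[OF p])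
  ultimately show ?thesis
    using that le_funD[of u p z] by force
qed

text \<open>The distance to \<open>M\<close> is sublinear, vanishes on \<open>M\<close>, is positive
  at \<open>z\<close> and is at most the norm. A linear functional below it that attains it at
  \<open>z\<close> is the one sought.\<close>

lemma separate_point_from_subspace_real:
  fixes M :: "'v::real_normed_vector set"
  assumes M: "subspace M" "closed M" and z: "z \<notin> M"
  obtains u :: "'v \<Rightarrow> real" where "bounded_linear u" "\<And>x. x \<in> M \<Longrightarrow> u x = 0" "u z \<noteq> 0"
proof -
  have ne: "M \<noteq> {}" using subspace_0[OF M(1)] by auto
  define p where "p x = infdist x M" for x
  have "p (x + y) \<le> p x + p y" for x y
  proof -
    have "p (x + y) - dist y n \<le> p x" if n: "n \<in> M" for n
    proof -
      have "p (x + y) - dist y n \<le> dist x m" if m: "m \<in> M" for m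
      proof -
        have "p (x + y) \<le> dist (x + y) (m + n)"
          unfolding p_def by (rule infdist_le) (use M m n subspace_add in blast)
        also have "\<dots> \<le> dist x m + dist y n" by (rule dist_triangle_add)
        finally show ?thesis by simp
      qed
      then show ?thesis unfolding p_def infdist_def[of x]
        using ne by (auto intro!: cINF_greatest)
    qed
    then have "p (x + y) - p x \<le> dist y n" if "n \<in> M" for n
      using that by (simp add: algebra_simps)
    then have "p (x + y) - p x \<le> p y"
      unfolding p_def infdist_def[of y] using ne by (auto intro!: cINF_greatest)
    then show ?thesis by simp
  qed
  moreover have "p (t *\<^sub>R x) \<le> t * p x" if t: "0 \<le> t" for t x
  proof (cases "t = 0")
    case True
    then show ?thesis using subspace_0[OF M(1)] by (simp add: p_def)
  next
    case False
    have "p (t *\<^sub>R x) / t \<le> dist x m" if m: "m \<in> M" for m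
    proof -
      have "p (t *\<^sub>R x) \<le> dist (t *\<^sub>R x) (t *\<^sub>R m)"
        unfolding p_def by (rule infdist_le) (use M m subspace_scale in blast)
      also have "\<dots> = t * dist x m"
        using t by (simp add: dist_norm flip: scaleR_diff_right)
      finally show ?thesis using t False by (simp add: field_simps)
    qed
    then have "p (t *\<^sub>R x) / t \<le> p x"
      unfolding p_def[of x] infdist_def[of x] using ne by (auto intro!: cINF_greatest)
    then show ?thesis using t False by (simp add: field_simps)
  qed
  ultimately have "sublinear p" by (simp add: sublinear_def)
  then obtain u where u: "linear u" "u \<le> p" "u z = p z"
    using Hahn_Banach_sublinear by blast
  \<comment> \<open>Used twice: with \<open>c = norm x\<close> for boundedness, and with
    \<open>c = 0\<close> for vanishing on \<open>M\<close>.\<close>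
  have abs: "\<bar>u x\<bar> \<le> c" if "p x \<le> c" "p (- x) \<le> c" for x c
    using le_funD[OF u(2), of x] le_funD[OF u(2), of "- x"] that linear_neg[OF u(1), of x] by simp
  have "p x \<le> norm x" for x
    unfolding p_def using infdist_le[OF subspace_0[OF M(1)], of x] by simp
  then have "\<bar>u x\<bar> \<le> norm x" for x
    using abs[of x "norm x"] by (metis norm_minus_cancel)
  then have "bounded_linear u"
    using u(1) by (intro bounded_linear_intro[of _ 1]) (auto simp: linear_add linear_scale)
  moreover have "u x = 0" if "x \<in> M" for x
    using abs[of x 0] that subspace_neg[OF M(1)] by (simp add: p_def)
  moreover have "u z \<noteq> 0"
    using u(3) z ne M(2) in_closed_iff_infdist_zero[of M z] by (auto simp: p_def)
  ultimately show ?thesis using that by blast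
qed

subsection \<open>The scalar field\<close>

text \<open>The map \<phi> preserves the norm and is therefore injective, so identities in the field
  can be checked in the complex numbers; \<open>i\<close> is the preimage of the imaginary
  unit.\<close>

lemma real_or_complex_cases:
  obtains (real) "\<And>c :: 'k::real_or_complex. \<exists>a. c = of_real a"
  | (complex) i :: "'k::real_or_complex" where "i * i = - 1" "\<And>c. \<exists>a b. c = of_real a + of_real b * i"
proof -
  obtain \<phi> :: "'k \<Rightarrow> complex" where add: "\<And>a b. \<phi> (a + b) = \<phi> a + \<phi> b"
    and mult: "\<And>a b. \<phi> (a * b) = \<phi> a * \<phi> b" and scale: "\<And>c a. \<phi> (c *\<^sub>R a) = c *\<^sub>R \<phi> a"
    and norm: "\<And>a. cmod (\<phi> a) = norm a" and range: "range \<phi> = \<real> \<or> range \<phi> = UNIV"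
    using real_or_complex[where 'a='k] by blast
  have "\<phi> 1 \<noteq> 0" using norm[of 1] by auto
  then have one: "\<phi> 1 = 1" using mult[of 1 1] by simp
  have of_real: "\<phi> (of_real a) = of_real a" for a
    by (simp add: of_real_def scale one)
  have inj: "a = b" if "\<phi> a = \<phi> b" for a b
    using add[of "a - b" b] norm[of "a - b"] that by simp
  show ?thesis
    using range
  proof
    assume R: "range \<phi> = \<real>"
    have "\<exists>a. c = of_real a" for c :: 'k
    proof -
      have "\<phi> c \<in> \<real>" using R by blast
      then show ?thesis by (metis inj of_real Reals_cases)
    qed
    then show ?thesis by (rule real)
  next
    assume C: "range \<phi> = UNIV"
    then obtain i where i: "\<phi> i = \<i>" by (metis surjD)
    have neg: "\<phi> (- 1) = - 1" using scale[of "- 1" 1] one by simp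
    have "i * i = - 1" by (rule inj) (simp add: mult i neg)
    moreover have "\<exists>a b. c = of_real a + of_real b * i" for c
    proof (intro exI)
      show "c = of_real (Re (\<phi> c)) + of_real (Im (\<phi> c)) * i"
        by (rule inj) (simp add: add mult of_real i complex_eq_iff)
    qed
    ultimately show ?thesis by (rule complex)
  qed
qed

text \<open>The set is, up to two added points, the image of a countable dense subset of the plane
  under the continuous surjection \<open>h\<close>.\<close>

lemma countable_dense_scalars:
  obtains K :: "'k::real_or_complex set" where "countable K" "0 \<in> K" "1 \<in> K" "closure K = UNIV"
proof -
  obtain i :: 'k where i: "\<And>c. \<exists>a b. c = of_real a + of_real b * i"
  proof (cases rule: real_or_complex_cases[where 'k='k])
    case real
    \<comment> \<open>For real scalars \<open>i = 0\<close> serves, so that both cases share the map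
      \<open>h\<close>.\<close>
    show ?thesis by (rule that[of 0]) (use real in auto)
  qed (use that in blast)
  define h :: "real \<times> real \<Rightarrow> 'k" where "h = (\<lambda>(a, b). of_real a + of_real b * i)"
  obtain T :: "(real \<times> real) set" where T: "countable T" "UNIV \<subseteq> closure T"
    using separable[of UNIV] by metis
  have "continuous_on (closure T) h"
    unfolding h_def case_prod_unfold by (intro continuous_intros)
  then have "h ` closure T \<subseteq> closure (h ` T)"
    by (rule image_closure_subset) (auto intro: closure_subset[THEN subsetD])
  moreover have "surj h"
    using i by (force simp: h_def surj_def)
  ultimately have "closure (h ` T) = UNIV"
    using T(2) by (metis top.extremum_unique)
  then have "closure (insert 0 (insert 1 (h ` T))) = UNIV"
    by (simp add: closure_insert)
  then show ?thesis
    using T by (intro that[of "insert 0 (insert 1 (h ` T))"]) auto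
qed

subsection \<open>Functionals and the weak* closure\<close>

context scaled_banach
begin

lemma bounded_bilinear_scale: "bounded_bilinear smul"
proof
  show "smul (a *\<^sub>R c) x = a *\<^sub>R smul c x" for a c x
    by (simp add: scaleR_conv_of_real scale_of_real flip: scale_scale)
  show "smul c (a *\<^sub>R x) = a *\<^sub>R smul c x" for a c x
    by (metis mult.commute scale_of_real scale_scale)
  show "\<exists>K. \<forall>c x. norm (smul c x) \<le> norm c * norm x * K"
    by (rule exI[of _ 1]) (simp add: norm_scale)
qed (simp_all add: scale_left_distrib scale_right_distrib)

lemma real_subspace: "subspace M \<Longrightarrow> real_vector.subspace M"
  by (metis real_vector.subspace_def scale_of_real subspace_def)

lemma dual_scale_arg: "f \<in> dual smul \<Longrightarrow> blinfun_apply f (smul c x) = c * blinfun_apply f x"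
  by (simp add: dual_def Vector_Spaces.linear_iff)

lemma dualI: "(\<And>c x. blinfun_apply f (smul c x) = c * blinfun_apply f x) \<Longrightarrow> f \<in> dual smul"
  by (simp add: dual_def Vector_Spaces.linear_iff vector_space_axioms
      vector_space_over_itself.vector_space_axioms blinfun.add_right)

lemma separate_point_from_subspace:
  assumes M: "subspace M" "closed M" and z: "z \<notin> M"
  obtains f where "f \<in> annihilator smul M" "blinfun_apply f z \<noteq> 0"
proof -
  obtain u :: "'a \<Rightarrow> real" where u: "bounded_linear u" "\<And>x. x \<in> M \<Longrightarrow> u x = 0" "u z \<noteq> 0"
    using separate_point_from_subspace_real[OF real_subspace[OF M(1)] M(2) z] by blast
  have blin: "bounded_linear (\<lambda>x. of_real (u x) :: 'k)" if "bounded_linear u" for u :: "'a \<Rightarrow> real"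
    by (rule bounded_linear_compose[OF bounded_linear_of_real that])
  interpret u: bounded_linear u by (rule u(1))
  show ?thesis
  proof (cases rule: real_or_complex_cases[where 'k='k])
    case real
    define f where "f = Blinfun (\<lambda>x. of_real (u x) :: 'k)"
    have f: "blinfun_apply f x = of_real (u x)" for x
      unfolding f_def by (subst bounded_linear_Blinfun_apply) (use blin[OF u(1)] in auto)
    have "f \<in> dual smul"
    proof (rule dualI)
      fix c :: 'k and x
      obtain a where "c = of_real a" using real by blast
      then show "blinfun_apply f (smul c x) = c * blinfun_apply f x"
        by (simp add: f scale_of_real u.scaleR)
    qed
    then show ?thesis
      using u by (intro that[of f]) (auto simp: annihilator_def f)
  next
    case (complex i)
    interpret B: bounded_bilinear smul by (rule bounded_bilinear_scale)
    \<comment> \<open>The usual complexification: the real-linear \<open>u\<close> becomes the real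
      part of \<open>f\<close>, and the sign of the second term makes \<open>f\<close> commute with
      multiplication by \<open>i\<close>.\<close>
    define f where "f = Blinfun (\<lambda>x. of_real (u x) - i * of_real (u (smul i x)) :: 'k)"
    have f: "blinfun_apply f x = of_real (u x) - i * of_real (u (smul i x))" for x
      unfolding f_def
      by (subst bounded_linear_Blinfun_apply)
        (auto intro!: bounded_linear_sub blin u(1) bounded_linear_compose[OF u(1)]
          bounded_linear_const_mult B.bounded_linear_right)
    have "f \<in> dual smul"
    proof (rule dualI)
      fix c :: 'k and x
      obtain a b where c: "c = of_real a + of_real b * i" using complex by blast
      have 1: "smul c x = a *\<^sub>R x + b *\<^sub>R smul i x"
        by (simp add: c scale_left_distrib scale_of_real flip: scale_scale)
      have "i * c = of_real a * i + of_real b * (i * i)"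
        by (simp add: c algebra_simps)
      then have "i * c = of_real a * i + of_real (- b)"
        by (simp add: complex(1))
      then have "smul i (smul c x) = smul (of_real a * i + of_real (- b)) x"
        by simp
      also have "\<dots> = smul (of_real a) (smul i x) + smul (of_real (- b)) x"
        by (simp only: scale_left_distrib scale_scale)
      finally have 2: "smul i (smul c x) = a *\<^sub>R smul i x - b *\<^sub>R x"
        by (simp only: scale_of_real) simp
      have ii: "i * (i * w) = - w" for w
        using complex(1) by (simp flip: mult.assoc)
      show "blinfun_apply f (smul c x) = c * blinfun_apply f x"
        unfolding f 2 unfolding 1 by (simp add: u.add u.diff u.scaleR c algebra_simps ii)
    qed
    moreover have "u (smul i x) = 0" if "x \<in> M" for x
      using that M(1) by (simp add: u(2) subspace_scale)
    \<comment> \<open>Vanishing would mean \<open>u z = i * u (i z)\<close>; squaring removes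
      \<open>i\<close> and leaves a sum of two real squares equal to zero.\<close>
    moreover have "blinfun_apply f z \<noteq> 0"
    proof
      assume "blinfun_apply f z = 0"
      then have "of_real (u z) = i * of_real (u (smul i z))" by (simp add: f)
      then have "of_real (u z) * of_real (u z)
          = i * of_real (u (smul i z)) * (i * of_real (u (smul i z)))" by simp
      also have "\<dots> = (i * i) * of_real (u (smul i z)) * of_real (u (smul i z))"
        by (simp only: ac_simps)
      finally have "(of_real (u z * u z) :: 'k) = of_real (- (u (smul i z) * u (smul i z)))"
        by (simp add: complex(1))
      then have "u z * u z = - (u (smul i z) * u (smul i z))"
        by (simp only: of_real_eq_iff)
      then have "(u z)\<^sup>2 + (u (smul i z))\<^sup>2 = 0"
        by (simp add: power2_eq_square)
      then show False
        using u(3) by (simp add: sum_power2_eq_zero_iff)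
    qed
    ultimately show ?thesis
      using u(2) by (intro that[of f]) (auto simp: annihilator_def f)
  qed
qed

text \<open>A basic weak* neighbourhood of \<open>f\<close> restricts values at finitely many points
  only, so a member of \<open>Y\<close> agreeing with \<open>f\<close> at those points lies in
  it.\<close>

lemma mem_weak_star_closure:
  assumes f: "f \<in> dual smul"
    and interpolate: "\<And>F. finite F \<Longrightarrow> \<exists>y\<in>Y. \<forall>x\<in>F. blinfun_apply y x = blinfun_apply f x"
    and Y: "Y \<subseteq> dual smul"
  shows "f \<in> weak_star smul closure_of Y"
  unfolding in_closure_of
proof (intro conjI allI impI)
  show "f \<in> topspace (weak_star smul)"
    using f by (simp add: weak_star_def topspace_pullback_topology)
next
  fix T assume T: "f \<in> T \<and> openin (weak_star smul) T"
  then obtain U where U: "open U" "T = blinfun_apply -` U \<inter> dual smul"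
    by (auto simp: weak_star_def openin_pullback_topology)
  then have "openin (product_topology (\<lambda>i. euclidean) UNIV) U" "blinfun_apply f \<in> U"
    using T by (auto simp: open_fun_def)
  from product_topology_open_contains_basis[OF this]
  obtain X where X: "blinfun_apply f \<in> (\<Pi>\<^sub>E i\<in>UNIV. X i)" "finite {i. X i \<noteq> UNIV}"
      "(\<Pi>\<^sub>E i\<in>UNIV. X i) \<subseteq> U"
    by auto
  obtain y where y: "y \<in> Y" "\<And>x. X x \<noteq> UNIV \<Longrightarrow> blinfun_apply y x = blinfun_apply f x"
    using interpolate[OF X(2)] by blast
  have "blinfun_apply y x \<in> X x" for x
    using X(1) y(2)[of x] by (cases "X x = UNIV") auto
  then have "y \<in> T" using X(3) U(2) y(1) Y by auto
  then show "\<exists>y. y \<in> Y \<and> y \<in> T" using y(1) by blast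
qed

text \<open>Being nonzero at \<open>x\<close> is a weak* open condition, so some member of
  \<open>Y\<close> would share it with \<open>f\<close>.\<close>

lemma weak_star_closure_vanishes:
  assumes f: "f \<in> weak_star smul closure_of Y" and x: "x \<in> preannihilator Y"
  shows "blinfun_apply f x = 0"
proof (rule ccontr)
  assume nz: "blinfun_apply f x \<noteq> 0"
  define T where "T = blinfun_apply -` {g. g x \<in> - {0}} \<inter> dual smul"
  have "open ((\<lambda>g :: 'a \<Rightarrow> 'k. g x) -` (- {0}))"
    by (rule open_vimage) auto
  then have "openin (weak_star smul) T"
    unfolding T_def weak_star_def openin_pullback_topology vimage_def by auto
  moreover have "f \<in> T"
    using nz f by (auto simp: T_def in_closure_of weak_star_def topspace_pullback_topology)
  ultimately obtain y where "y \<in> Y" "y \<in> T"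
    using f unfolding in_closure_of by blast
  then show False
    using x by (auto simp: T_def preannihilator_def)
qed

text \<open>
  In the induction step a functional \<open>y0 \<in> Y\<close> with \<open>y0 a = 1\<close> is split off: \<open>Y\<close> is replaced by
  its members vanishing at \<open>a\<close> and \<open>f\<close> by \<open>f - f a * y0\<close>.
\<close>

lemma finite_interpolation:
  assumes "finite F" and "Y \<subseteq> dual smul" and "module.subspace dual_scale Y" and "f \<in> dual smul"
    and "\<And>x. x \<in> span F \<Longrightarrow> x \<in> preannihilator Y \<Longrightarrow> blinfun_apply f x = 0"
  shows "\<exists>y\<in>Y. \<forall>x\<in>F. blinfun_apply y x = blinfun_apply f x"
  using assms
proof (induction F arbitrary: Y f)
  case empty
  interpret D: scaled_banach "dual_scale :: _ \<Rightarrow> ('a \<Rightarrow>\<^sub>L 'k) \<Rightarrow> _"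
    by (rule scaled_banach_dual_scale)
  show ?case using D.subspace_0[OF empty.prems(2)] by auto
next
  case (insert a F)
  interpret D: scaled_banach "dual_scale :: _ \<Rightarrow> ('a \<Rightarrow>\<^sub>L 'k) \<Rightarrow> _"
    by (rule scaled_banach_dual_scale)
  note sub = D.subspace_add[OF insert.prems(2)] D.subspace_diff[OF insert.prems(2)]
    D.subspace_scale[OF insert.prems(2)] D.subspace_0[OF insert.prems(2)]
  have mono: "x \<in> span (insert a F)" if "x \<in> span F" for x
    using that span_mono[of F "insert a F"] by auto
  show ?case
  proof (cases "\<forall>y\<in>Y. blinfun_apply y a = 0")
    case True
    then have "blinfun_apply f a = 0"
      by (intro insert.prems) (auto simp: preannihilator_def span_base)
    moreover have "\<exists>y\<in>Y. \<forall>x\<in>F. blinfun_apply y x = blinfun_apply f x"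
      by (rule insert.IH) (use insert.prems mono in auto)
    ultimately show ?thesis using True by auto
  next
    case False
    then obtain y1 where y1: "y1 \<in> Y" "blinfun_apply y1 a \<noteq> 0" by blast
    define y0 where "y0 = dual_scale (inverse (blinfun_apply y1 a)) y1"
    have y0: "y0 \<in> Y" "blinfun_apply y0 a = 1"
      using y1 sub by (auto simp: y0_def)
    define Y' where "Y' = {y \<in> Y. blinfun_apply y a = 0}"
    define f' where "f' = f - dual_scale (blinfun_apply f a) y0"
    have "\<exists>y\<in>Y'. \<forall>x\<in>F. blinfun_apply y x = blinfun_apply f' x"
    proof (rule insert.IH)
      show "Y' \<subseteq> dual smul" using insert.prems by (auto simp: Y'_def)
      show "D.subspace Y'"
        by (rule D.subspaceI) (auto simp: Y'_def sub blinfun.add_left)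
      show "f' \<in> dual smul"
        unfolding f'_def
        using y0 insert.prems subspace_dual[OF scaled_banach_axioms]
        by (auto intro!: D.subspace_diff D.subspace_scale)
    next
      fix x assume x: "x \<in> span F" "x \<in> preannihilator Y'"
      \<comment> \<open>The dual correction: a functional \<open>y\<close> takes at
        \<open>x'\<close> the value of \<open>y - y a * y0\<close> at \<open>x\<close>. For
        \<open>y \<in> Y\<close> the latter functional lies in \<open>Y'\<close>, and for
        \<open>y = f\<close> it is \<open>f'\<close>.\<close>
      define x' where "x' = x - smul (blinfun_apply y0 x) a"
      have app: "blinfun_apply y x' = blinfun_apply y x - blinfun_apply y0 x * blinfun_apply y a"
        if "y \<in> dual smul" for y
        using that by (simp add: x'_def blinfun.diff_right dual_scale_arg)
      have "blinfun_apply y x' = 0" if y: "y \<in> Y" for y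
      proof -
        have "y - dual_scale (blinfun_apply y a) y0 \<in> Y'"
          using y y0 sub by (auto simp: Y'_def blinfun.diff_left)
        then have "blinfun_apply y x = blinfun_apply y a * blinfun_apply y0 x"
          using x(2) by (force simp: preannihilator_def blinfun.diff_left)
        then show ?thesis using app y insert.prems by auto
      qed
      then have "x' \<in> preannihilator Y" by (simp add: preannihilator_def)
      moreover have "x' \<in> span (insert a F)"
        unfolding x'_def using x mono by (intro span_diff span_scale) (auto intro: span_base)
      ultimately have "blinfun_apply f x' = 0" using insert.prems by blast
      then show "blinfun_apply f' x = 0"
        using app[of f] insert.prems by (simp add: f'_def blinfun.diff_left algebra_simps)
    qed
    then obtain y where y: "y \<in> Y'" "\<And>x. x \<in> F \<Longrightarrow> blinfun_apply y x = blinfun_apply f' x"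
      by blast
    show ?thesis
    proof
      \<comment> \<open>Adding back the part split off gives the value \<open>f a\<close> at
        \<open>a\<close>, because \<open>y a = 0\<close> and \<open>y0 a = 1\<close>.\<close>
      show "y + dual_scale (blinfun_apply f a) y0 \<in> Y"
        using y y0 sub by (auto simp: Y'_def)
      show "\<forall>x\<in>insert a F. blinfun_apply (y + dual_scale (blinfun_apply f a) y0) x
          = blinfun_apply f x"
        using y y0 by (auto simp: Y'_def f'_def blinfun.add_left blinfun.diff_left)
    qed
  qed
qed

text \<open>The bipolar theorem for subspaces. A functional vanishing on the preannihilator agrees
  on each finite set with some member of \<open>Y\<close>, so finite interpolation already
  suffices.\<close>

lemma weak_star_closure_of_subspace:
  assumes Y: "Y \<subseteq> dual smul" "module.subspace dual_scale Y"
  shows "weak_star smul closure_of Y = annihilator smul (preannihilator Y)"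
proof (intro equalityI subsetI)
  fix f assume f: "f \<in> weak_star smul closure_of Y"
  then have "f \<in> dual smul"
    by (auto simp: in_closure_of weak_star_def topspace_pullback_topology)
  then show "f \<in> annihilator smul (preannihilator Y)"
    using weak_star_closure_vanishes[OF f] by (simp add: annihilator_def)
next
  fix f assume "f \<in> annihilator smul (preannihilator Y)"
  then show "f \<in> weak_star smul closure_of Y"
    using Y by (intro mem_weak_star_closure finite_interpolation) (auto simp: annihilator_def)
qed

end

subsection \<open>Projections from norming subspaces\<close>

text \<open>The quantifier over upper bounds \<open>c\<close> replaces the supremum, so no side conditions are needed.\<close>

definition norming_on :: "real \<Rightarrow> 'a::banach set \<Rightarrow> ('a \<Rightarrow>\<^sub>L 'k::real_or_complex) set \<Rightarrow> bool" where
  "norming_on r V Y \<longleftrightarrow>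
     (\<forall>x\<in>V. \<forall>c. (\<forall>f \<in> Y \<inter> cball 0 1. norm (blinfun_apply f x) \<le> c) \<longrightarrow> norm x \<le> r * c)"

lemma norming_on_mono: "norming_on r V Y \<Longrightarrow> V' \<subseteq> V \<Longrightarrow> Y \<subseteq> Y' \<Longrightarrow> norming_on r V' Y'"
  unfolding norming_on_def by (meson IntD1 IntD2 IntI subsetD)

lemma norming_on_Union: "(\<And>i. norming_on r (V i) Y) \<Longrightarrow> norming_on r (\<Union>i. V i) Y"
  unfolding norming_on_def by blast

lemma norm_blinfun_le_unit_ball: "f \<in> cball 0 1 \<Longrightarrow> norm (blinfun_apply f x) \<le> norm x"
  using norm_blinfun[of f x] mult_right_mono[of "norm f" 1 "norm x"] by simp

lemma norming_on_closure:
  assumes V: "norming_on r V Y" and r: "0 \<le> r"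
  shows "norming_on r (closure V) Y"
  unfolding norming_on_def
proof (intro ballI allI impI)
  fix x c assume x: "x \<in> closure V" and c: "\<forall>f \<in> Y \<inter> cball 0 1. norm (blinfun_apply f x) \<le> c"
  show "norm x \<le> r * c"
  proof (rule field_le_epsilon)
    fix e :: real assume e: "0 < e"
    \<comment> \<open>Replacing \<open>x\<close> by a point \<open>v\<close> within \<open>d\<close>
      costs \<open>d\<close> in the norm and raises the bound \<open>c\<close> by \<open>d\<close>,
      in total \<open>(r + 1) * d = e\<close>.\<close>
    define d where "d = e / (r + 1)"
    have "0 < d" using e r by (simp add: d_def)
    moreover have "(r + 1) * d = e" using r by (simp add: d_def)
    ultimately have d: "0 < d" "r * d + d = e" by (simp_all add: algebra_simps)
    obtain v where v: "v \<in> V" "dist v x < d"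
      using x d(1) closure_approachable by blast
    have "norm (blinfun_apply f v) \<le> c + d" if f: "f \<in> Y \<inter> cball 0 1" for f
    proof -
      have "norm (blinfun_apply f v) \<le> norm (blinfun_apply f x) + norm (blinfun_apply f (v - x))"
        using norm_triangle_ineq[of "blinfun_apply f x" "blinfun_apply f (v - x)"]
        by (simp flip: blinfun.add_right)
      also have "\<dots> \<le> c + d"
        using c f v(2) norm_blinfun_le_unit_ball[of f "v - x"] by (force simp: dist_norm)
      finally show ?thesis .
    qed
    then have "norm v \<le> r * (c + d)"
      using V v(1) by (auto simp: norming_on_def)
    then show "norm x \<le> r * c + e"
      using v(2) d(2) norm_triangle_ineq[of "x - v" v]
      by (simp add: dist_norm norm_minus_commute algebra_simps)
  qed
qed

context scaled_banach
begin

lemma subspace_preannihilator: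
  assumes "Y \<subseteq> dual smul"
  shows "subspace (preannihilator Y)"
  by (rule subspaceI)
    (use assms in \<open>auto simp: preannihilator_def blinfun.add_right dual_scale_arg subset_iff\<close>)

lemma closed_preannihilator: "closed (preannihilator Y)"
proof -
  have "preannihilator Y = (\<Inter>y\<in>Y. blinfun_apply y -` {0})"
    by (auto simp: preannihilator_def)
  moreover have "closed (blinfun_apply y -` {0})" for y
    by (intro closed_vimage closed_singleton linear_continuous_on blinfun.bounded_linear_right)
  ultimately show ?thesis by (auto intro: closed_INT)
qed

text \<open>The projection onto \<open>V\<close> is taken along \<open>N\<close>, the preannihilator
  of \<open>Y\<close>. The functionals fixed by its adjoint are those vanishing on \<open>N\<close>,
  and these form the weak* closure of \<open>Y\<close>.\<close>

lemma projection_exists: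
  assumes V: "subspace V" "closed V"
    and Y: "Y \<subseteq> dual smul" "module.subspace dual_scale Y"
    and r: "0 < r" and norming: "norming_on r V Y"
    and ann: "annihilator smul V \<inter> (weak_star smul closure_of Y) = {0}"
  obtains P where "bounded_projection smul P" "norm P \<le> r" "range (blinfun_apply P) = V"
    "blinfun_apply P -` {0} = preannihilator Y" "adjoint_range smul P = weak_star smul closure_of Y"
proof -
  define N where "N = preannihilator Y"
  have N: "subspace N" "closed N"
    using subspace_preannihilator[OF Y(1)] closed_preannihilator by (auto simp: N_def)
  note subV = subspace_0[OF V(1)] subspace_add[OF V(1)] subspace_diff[OF V(1)] subspace_scale[OF V(1)]
  note subN = subspace_0[OF N(1)] subspace_add[OF N(1)] subspace_diff[OF N(1)] subspace_scale[OF N(1)]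
    subspace_neg[OF N(1)]
  \<comment> \<open>Members of \<open>Y\<close> do not see \<open>z\<close>, so their values at
    \<open>v\<close> are values at \<open>v + z\<close>.\<close>
  have est: "norm v \<le> r * norm (v + z)" if v: "v \<in> V" and z: "z \<in> N" for v z
  proof -
    have "norm (blinfun_apply f v) \<le> norm (v + z)" if f: "f \<in> Y \<inter> cball 0 1" for f
      using norm_blinfun_le_unit_ball[of f "v + z"] f z
      by (auto simp: blinfun.add_right N_def preannihilator_def)
    then show ?thesis using norming v by (auto simp: norming_on_def)
  qed
  \<comment> \<open>This is the sum of \<open>V\<close> and \<open>N\<close>; it will turn out to be
    the whole space.\<close>
  define M where "M = {x. \<exists>v\<in>V. x - v \<in> N}"
  have "subspace M"
  proof (rule subspaceI)
    show "0 \<in> M" using subV(1) subN(1) by (auto simp: M_def intro!: bexI[of _ 0])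
    show "x + y \<in> M" if xy: "x \<in> M" "y \<in> M" for x y
    proof -
      obtain v w where "v \<in> V" "w \<in> V" "x - v \<in> N" "y - w \<in> N"
        using xy unfolding M_def by blast
      then show ?thesis
        using subN(2)[of "x - v" "y - w"] subV(2)[of v w]
        by (auto simp: M_def algebra_simps intro!: bexI[of _ "v + w"])
    qed
    show "smul c x \<in> M" if x: "x \<in> M" for c x
    proof -
      obtain v where "v \<in> V" "x - v \<in> N"
        using x by (auto simp: M_def)
      then show ?thesis
        using subN(4)[of "x - v" c] subV(4)[of v c]
        by (auto simp: M_def scale_right_diff_distrib intro!: bexI[of _ "smul c v"])
    qed
  qed
  moreover have "closed M"
    unfolding closed_sequential_limits
  proof (intro allI impI)
    fix w l assume w: "(\<forall>n. w n \<in> M) \<and> w \<longlonglongrightarrow> l"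
    then obtain v where v: "\<And>n. v n \<in> V" "\<And>n. w n - v n \<in> N"
      unfolding M_def by simp metis
    have "Cauchy w" using w LIMSEQ_imp_Cauchy by blast
    \<comment> \<open>Closedness of the sum: \<open>est\<close>, applied to differences of the
      decompositions, transfers the Cauchy property from \<open>w\<close> to the components in
      \<open>V\<close>.\<close>
    have "Cauchy v"
    proof (rule metric_CauchyI)
      fix e :: real assume "0 < e"
      then obtain K where K: "\<And>m n. m \<ge> K \<Longrightarrow> n \<ge> K \<Longrightarrow> dist (w m) (w n) < e / r"
        using metric_CauchyD[OF \<open>Cauchy w\<close>, of "e / r"] r by auto
      have "dist (v m) (v n) < e" if "m \<ge> K" "n \<ge> K" for m n
      proof -
        have "dist (v m) (v n) \<le> r * dist (w m) (w n)"
          using est[OF subV(3)[OF v(1)[of m] v(1)[of n]] subN(3)[OF v(2)[of m] v(2)[of n]]]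
          by (simp add: dist_norm algebra_simps)
        also have "\<dots> < e" using K[OF that] r by (simp add: field_simps)
        finally show ?thesis .
      qed
      then show "\<exists>K. \<forall>m\<ge>K. \<forall>n\<ge>K. dist (v m) (v n) < e" by blast
    qed
    then obtain a where a: "v \<longlonglongrightarrow> a"
      using Cauchy_convergent_iff convergent_def by blast
    have "a \<in> V" using closed_sequentially[OF V(2) _ a] v by blast
    moreover have "(\<lambda>n. w n - v n) \<longlonglongrightarrow> l - a" using w a by (intro tendsto_diff) auto
    then have "l - a \<in> N" by (rule closed_sequentially[OF N(2) v(2)])
    ultimately show "l \<in> M" by (auto simp: M_def)
  qed
  \<comment> \<open>A functional separating a point from \<open>M\<close> would vanish on
    \<open>V\<close> and on \<open>N\<close>; by the second it lies in the weak* closure of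
    \<open>Y\<close>, so \<open>ann\<close> makes it zero.\<close>
  ultimately have M_UNIV: "x \<in> M" for x
  proof (rule_tac ccontr)
    assume "subspace M" "closed M" "x \<notin> M"
    then obtain f where f: "f \<in> annihilator smul M" "blinfun_apply f x \<noteq> 0"
      using separate_point_from_subspace by blast
    have "V \<subseteq> M" "N \<subseteq> M"
      using subN(1) subV(1) by (force simp: M_def)+
    then have "f \<in> annihilator smul V \<inter> annihilator smul N"
      using f(1) by (auto simp: annihilator_def)
    then have "f = 0"
      using ann weak_star_closure_of_subspace[OF Y] by (auto simp: N_def)
    then show False using f(2) by simp
  qed
  then have "\<forall>x. \<exists>v. v \<in> V \<and> x - v \<in> N" by (auto simp: M_def)
  then obtain p where p: "\<And>x. p x \<in> V" "\<And>x. x - p x \<in> N" by metis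
  \<comment> \<open>The difference of two decompositions of \<open>x\<close> represents zero, and
    \<open>est\<close> then bounds its component in \<open>V\<close> by zero. Linearity of
    \<open>p\<close> follows from this uniqueness.\<close>
  have uniq: "p x = v" if "v \<in> V" "x - v \<in> N" for x v
    using est[OF subV(3)[OF p(1)[of x] that(1)] subN(3)[OF p(2)[of x] that(2)]] by simp
  have add: "p (x + y) = p x + p y" for x y
    using subV(2)[OF p(1) p(1), of x y] subN(2)[OF p(2) p(2), of x y]
    by (intro uniq) (simp_all add: algebra_simps)
  have scale: "p (smul c x) = smul c (p x)" for c x
    using subV(4)[OF p(1), of c x] subN(4)[OF p(2), of c x]
    by (intro uniq) (simp_all add: scale_right_diff_distrib)
  have bound: "norm (p x) \<le> r * norm x" for x
    using est[OF p, of x x] by simp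
  have "bounded_linear p"
    by (rule bounded_linear_intro[of _ r])
      (use add scale[of "of_real _"] bound in \<open>auto simp: scale_of_real mult.commute\<close>)
  then obtain P where P: "blinfun_apply P = p"
    using bounded_linear_Blinfun_apply by blast
  have pV: "p v = v" if "v \<in> V" for v
    using that subN(1) by (intro uniq) auto
  have ker: "p x = 0 \<longleftrightarrow> x \<in> N" for x
    using p(2)[of x] uniq[OF subV(1), of x] by auto
  show ?thesis
  proof
    show "bounded_projection smul P"
      by (auto simp: bounded_projection_def Vector_Spaces.linear_iff vector_space_axioms P add scale
          pV p intro!: blinfun_eqI)
    show "norm P \<le> r"
      by (rule norm_blinfun_bound) (use bound r P in auto)
    show "range (blinfun_apply P) = V"
      using p(1) pV P by (metis image_subsetI rangeI subsetI subset_antisym)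
    show "blinfun_apply P -` {0} = preannihilator Y"
      using ker by (auto simp: P N_def)
    show "adjoint_range smul P = weak_star smul closure_of Y"
      unfolding weak_star_closure_of_subspace[OF Y] N_def[symmetric]
    proof (intro equalityI subsetI)
      fix g assume "g \<in> adjoint_range smul P"
      then obtain f where "f \<in> dual smul" "g = f o\<^sub>L P" by (auto simp: adjoint_range_def)
      moreover then have "g \<in> dual smul"
        by (intro dualI) (simp add: P scale dual_scale_arg)
      ultimately show "g \<in> annihilator smul N"
        by (auto simp: annihilator_def P ker[THEN iffD2])
    next
      fix f assume f: "f \<in> annihilator smul N"
      have "f = f o\<^sub>L P"
      proof (rule blinfun_eqI)
        fix x
        have "blinfun_apply f (x - p x) = 0" using f p(2) by (auto simp: annihilator_def)
        then show "blinfun_apply f x = blinfun_apply (f o\<^sub>L P) x"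
          by (simp add: blinfun.diff_right P)
      qed
      then show "f \<in> adjoint_range smul P"
        using f by (auto simp: adjoint_range_def annihilator_def)
    qed
  qed
qed

end

subsection \<open>Closed separable subspaces\<close>

lemma separable_space_top_of_closed:
  assumes "closed V"
  shows "separable_space (top_of_set V) \<longleftrightarrow> (\<exists>C. countable C \<and> closure C = V)"
proof -
  have "C \<subseteq> V \<and> V \<inter> closure (V \<inter> C) = V \<longleftrightarrow> closure C = V" for C
    using assms closure_subset[of C] closure_minimal[of C V] by (auto simp: Int_absorb1)
  then show ?thesis
    by (auto simp: separable_space_def closure_of_subtopology)
qed

text \<open>Iterating the enlargement countably often suffices: the stages increase, so any two
  points of the union lie in a common stage, and the next one contains \<open>G x y\<close>.\<close>

lemma countable_closed_superset:
  assumes A: "countable A" "A \<subseteq> U"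
    and G: "\<And>x y. x \<in> U \<Longrightarrow> y \<in> U \<Longrightarrow> countable (G x y) \<and> G x y \<subseteq> U"
  obtains T where "countable T" "A \<subseteq> T" "T \<subseteq> U" "\<And>x y. x \<in> T \<Longrightarrow> y \<in> T \<Longrightarrow> G x y \<subseteq> T"
proof -
  define S where "S n = ((\<lambda>A. A \<union> (\<Union>x\<in>A. \<Union>y\<in>A. G x y)) ^^ n) A" for n
  have S_0: "S 0 = A" and S_Suc: "S (Suc n) = S n \<union> (\<Union>x\<in>S n. \<Union>y\<in>S n. G x y)" for n
    by (simp_all add: S_def)
  have S: "countable (S n) \<and> S n \<subseteq> U" for n
  proof (induction n)
    case 0
    then show ?case using A by (simp add: S_0)
  next
    case (Suc n)
    then have "countable (G x y) \<and> G x y \<subseteq> U" if "x \<in> S n" "y \<in> S n" for x y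
      using that G by blast
    with Suc show ?case
      unfolding S_Suc by (intro conjI countable_Un countable_UN Un_least UN_least) auto
  qed
  have mono: "S m \<subseteq> S n" if "m \<le> n" for m n
    using lift_Suc_mono_le[OF _ that, of S] by (auto simp: S_Suc)
  show ?thesis
  proof (rule that[of "\<Union>n. S n"])
    fix x y assume "x \<in> (\<Union>n. S n)" "y \<in> (\<Union>n. S n)"
    then obtain m n where "x \<in> S m" "y \<in> S n" by blast
    then have "x \<in> S (max m n)" "y \<in> S (max m n)"
      using mono[of m "max m n"] mono[of n "max m n"] by auto
    then have "G x y \<subseteq> S (Suc (max m n))" by (auto simp: S_Suc)
    then show "G x y \<subseteq> (\<Union>n. S n)" by blast
  qed (use S S_0 in auto)
qed

context scaled_banach
begin

text \<open>A countable set can only be closed under combinations with countably many coefficients.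
  Continuity of the combination map jointly in scalars and vectors extends this to all coefficients
  on the closure.\<close>

lemma subspace_closure_if_dense_scalars:
  fixes K :: "'k set"
  assumes K: "closure K = UNIV" and ne: "S \<noteq> {}"
    and S: "\<And>c d x y. c \<in> K \<Longrightarrow> d \<in> K \<Longrightarrow> x \<in> S \<Longrightarrow> y \<in> S \<Longrightarrow> smul c x + smul d y \<in> S"
  shows "subspace (closure S)"
proof -
  interpret B: bounded_bilinear smul by (rule bounded_bilinear_scale)
  define g where "g = (\<lambda>(c, d, x, y). smul c x + smul d y)"
  have "continuous_on (closure (K \<times> K \<times> S \<times> S)) g"
    unfolding g_def case_prod_unfold by (intro continuous_intros B.continuous_on)
  moreover have "g ` (K \<times> K \<times> S \<times> S) \<subseteq> S"
    using S by (auto simp: g_def)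
  ultimately have "g ` closure (K \<times> K \<times> S \<times> S) \<subseteq> closure S"
    using closure_subset[of S] by (intro image_closure_subset) auto
  then have g: "smul c x + smul d y \<in> closure S" if "x \<in> closure S" "y \<in> closure S" for c d x y
    using that by (force simp: closure_Times K g_def)
  obtain z where z: "z \<in> closure S" using ne closure_subset by blast
  show ?thesis
    \<comment> \<open>The coefficients \<open>0, 0\<close> give the zero vector, \<open>1, 1\<close>
      give sums, and a zero second coefficient gives multiples.\<close>
    by (rule subspaceI) (use g[OF z z, of 0 0] g[of _ _ 1 1] g[of _ _ _ 0] in auto)
qed

lemma subspace_closure: "subspace S \<Longrightarrow> subspace (closure S)"
  by (rule subspace_closure_if_dense_scalars[of UNIV])
    (auto simp: subspace_scale subspace_add dest: subspace_0)

lemma subspace_closure_incseq: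
  assumes "\<And>i :: nat. subspace (V i)" "incseq V"
  shows "subspace (closure (\<Union>i. V i))"
proof (rule subspace_closure, rule subspaceI)
  fix x y assume "x \<in> (\<Union>i. V i)" "y \<in> (\<Union>i. V i)"
  then obtain i j where "x \<in> V i" "y \<in> V j" by blast
  then have "x \<in> V (max i j)" "y \<in> V (max i j)"
    using incseqD[OF assms(2), of i "max i j"] incseqD[OF assms(2), of j "max i j"] by auto
  then show "x + y \<in> (\<Union>i. V i)" using subspace_add[OF assms(1)] by blast
qed (use subspace_0[OF assms(1)] subspace_scale[OF assms(1)] in blast)+

end

lemma mem_closed_separable_subspaces:
  "V \<in> closed_separable_subspaces s Z \<longleftrightarrow>
     V \<subseteq> Z \<and> module.subspace s V \<and> closed V \<and> (\<exists>C. countable C \<and> closure C = V)"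
  by (auto simp: closed_separable_subspaces_def separable_space_top_of_closed)

lemma closed_separable_subspaces_closure_incseq:
  fixes s :: "'k::real_or_complex \<Rightarrow> 'v::banach \<Rightarrow> 'v"
  assumes "scaled_banach s" and V: "\<And>i :: nat. V i \<in> closed_separable_subspaces s Z"
    and "incseq V" and Z: "closed Z"
  shows "closure (\<Union>i. V i) \<in> closed_separable_subspaces s Z"
proof -
  interpret scaled_banach s by fact
  obtain C where C: "\<And>i. countable (C i)" "\<And>i. closure (C i) = V i"
    using V unfolding mem_closed_separable_subspaces by metis
  have "closure (\<Union>i. C i) = closure (\<Union>i. V i)"
  proof (rule antisym)
    show "closure (\<Union>i. C i) \<subseteq> closure (\<Union>i. V i)"
      using C(2) closure_subset by (intro closure_mono) blast
    show "closure (\<Union>i. V i) \<subseteq> closure (\<Union>i. C i)"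
      using C(2) by (intro closure_minimal) (auto simp flip: C(2) intro: closure_mono[THEN subsetD])
  qed
  moreover have "countable (\<Union>i. C i)" using C(1) by auto
  moreover have "subspace (closure (\<Union>i. V i))"
    using V assms(3) by (intro subspace_closure_incseq) (auto simp: mem_closed_separable_subspaces)
  moreover have "closure (\<Union>i. V i) \<subseteq> Z"
    using V Z by (intro closure_minimal) (auto simp: mem_closed_separable_subspaces)
  ultimately show ?thesis
    by (auto simp: mem_closed_separable_subspaces)
qed

text \<open>A sequence of functionals nearly attaining the supremum at \<open>x\<close> norms that
  point. This is what lets the closing-off argument stay countable.\<close>

lemma countable_norming_subset:
  assumes D: "r_norming smul r D" and ne: "D \<inter> cball 0 1 \<noteq> {}" and r: "0 \<le> r"
  obtains N where "countable N" "N \<subseteq> D" "norming_on r {x} N"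
proof -
  define s where "s = (SUP f \<in> D \<inter> cball 0 1. norm (blinfun_apply f x))"
  have bdd: "bdd_above ((\<lambda>f. norm (blinfun_apply f x)) ` (D \<inter> cball 0 1))"
    by (rule bdd_aboveI2[of _ _ "norm x"]) (simp add: norm_blinfun_le_unit_ball)
  have "\<exists>f. f \<in> D \<inter> cball 0 1 \<and> s - 1 / real (Suc n) < norm (blinfun_apply f x)" for n
    using less_cSUP_iff[OF ne bdd, of "s - 1 / real (Suc n)"] by (auto simp: s_def)
  then obtain F where F: "\<And>n. F n \<in> D \<inter> cball 0 1"
      "\<And>n. s - 1 / real (Suc n) < norm (blinfun_apply (F n) x)"
    by metis
  have "norming_on r {x} (range F)"
    unfolding norming_on_def
  proof (intro ballI allI impI)
    fix x' c assume "x' \<in> {x}" and c: "\<forall>f \<in> range F \<inter> cball 0 1. norm (blinfun_apply f x') \<le> c"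
    then have x': "x' = x" by simp
    have "s \<le> c"
    proof (rule field_le_epsilon)
      fix e :: real assume "0 < e"
      then obtain n where "inverse (real (Suc n)) < e" using reals_Archimedean by blast
      moreover have "norm (blinfun_apply (F n) x) \<le> c" using c F(1)[of n] x' by auto
      ultimately show "s \<le> c + e" using F(2)[of n] by (simp add: inverse_eq_divide)
    qed
    moreover have "norm x \<le> r * s" using D by (simp add: r_norming_def s_def)
    ultimately show "norm x' \<le> r * c"
      unfolding x' using mult_left_mono[OF _ r, of s c] by linarith
  qed
  then show ?thesis using F(1) by (intro that[of "range F"]) auto
qed

subsection \<open>The rich family of rectangles\<close>

locale projectional_generator_space = scaled_banach smul
  for smul :: "'k::real_or_complex \<Rightarrow> 'a::banach \<Rightarrow> 'a" +
  fixes D :: "('a \<Rightarrow>\<^sub>L 'k) set" and \<Phi> :: "('a \<Rightarrow>\<^sub>L 'k) \<Rightarrow> 'a set" and r :: real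
  assumes generator: "projectional_generator smul D \<Phi>" and r: "r \<ge> 1"
    and r_norming: "r_norming smul r D"
begin

sublocale D: scaled_banach "dual_scale :: 'k \<Rightarrow> ('a \<Rightarrow>\<^sub>L 'k) \<Rightarrow> _"
  by (rule scaled_banach_dual_scale)

sublocale vector_space_prod smul "dual_scale :: 'k \<Rightarrow> ('a \<Rightarrow>\<^sub>L 'k) \<Rightarrow> _" ..

lemma D: "D \<subseteq> dual smul" "closed D" "D.subspace D" "0 \<in> D"
  using generator r_norming D.subspace_0
  by (auto simp: projectional_generator_def r_norming_def)

text \<open>The last condition concerns a countable dense \<open>E\<close> rather than all of
  \<open>Y\<close>, since the generator speaks of countable sets and \<Phi> of an uncountable
  \<open>Y\<close> need not fit into a separable \<open>V\<close>. As \<open>E\<close> is not fixed,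
  the dense sets along an increasing sequence can be united.\<close>

definition admissible :: "'a set \<Rightarrow> ('a \<Rightarrow>\<^sub>L 'k) set \<Rightarrow> bool" where
  "admissible V Y \<longleftrightarrow>
     V \<in> closed_separable_subspaces smul UNIV \<and> Y \<in> closed_separable_subspaces dual_scale D \<and>
     norming_on r V Y \<and> (\<exists>E. countable E \<and> closure E = Y \<and> (\<Union>e\<in>E. \<Phi> e) \<subseteq> V)"

definition admissible_rectangles :: "('a \<times> ('a \<Rightarrow>\<^sub>L 'k)) set set" where
  "admissible_rectangles = {V \<times> Y | V Y. admissible V Y}"

text \<open>Both sides are nonempty, so the projections of a rectangle recover them.\<close>

lemma admissible_zero: "admissible V Y \<Longrightarrow> 0 \<in> V \<and> 0 \<in> Y"
  by (auto simp: admissible_def mem_closed_separable_subspaces subspace_0 D.subspace_0)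

text \<open>Since \<open>V\<close> contains the values of \<Phi> on \<open>E\<close>, its
  annihilator is among the functionals that the generator separates from the weak* closure of
  \<open>Y\<close>.\<close>

lemma admissible_projection:
  assumes "admissible V Y"
  obtains P where "bounded_projection smul P" "norm P \<le> r" "range (blinfun_apply P) = V"
    "blinfun_apply P -` {0} = preannihilator Y" "adjoint_range smul P = weak_star smul closure_of Y"
proof -
  have V: "subspace V" "closed V" and Y: "D.subspace Y" "Y \<subseteq> D"
    using assms by (auto simp: admissible_def mem_closed_separable_subspaces)
  obtain E where E: "countable E" "closure E = Y" "(\<Union>e\<in>E. \<Phi> e) \<subseteq> V"
    using assms by (auto simp: admissible_def)
  have "E \<subseteq> D" using E(2) Y(2) closure_subset by blast
  then have "annihilator smul (\<Union>e\<in>E. \<Phi> e) \<inter> (weak_star smul closure_of Y) = {0}"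
    using generator E Y(1) unfolding projectional_generator_def by blast
  moreover have "annihilator smul V \<subseteq> annihilator smul (\<Union>e\<in>E. \<Phi> e)"
    using E(3) by (auto simp: annihilator_def)
  moreover have "0 \<in> annihilator smul V \<inter> (weak_star smul closure_of Y)"
    using D.subspace_0[OF Y(1)] D(1) Y(2) D(4)
    by (auto simp: annihilator_def weak_star_closure_of_subspace Y(1))
  ultimately have "annihilator smul V \<inter> (weak_star smul closure_of Y) = {0}" by blast
  then show ?thesis
    using projection_exists[OF V _ Y(1), of r] Y(2) D(1) assms r that
    by (force simp: admissible_def)
qed

text \<open>Stated for countable sets, this yields richness when applied to a dense set,
  directedness for a union of two dense sets, and the covering of the space and of \<open>D\<close>
  for single points.\<close>

lemma admissible_rectangles_cofinal:
  assumes C: "countable C" "C \<subseteq> UNIV \<times> D"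
  obtains w where "w \<in> admissible_rectangles" "C \<subseteq> w"
proof -
  obtain K :: "'k set" where K: "countable K" "0 \<in> K" "1 \<in> K" "closure K = UNIV"
    using countable_dense_scalars by blast
  have "\<exists>N. countable N \<and> N \<subseteq> D \<and> norming_on r {x} N" for x
  proof -
    have "D \<inter> cball 0 1 \<noteq> {}" using D(4) by auto
    then obtain N where "countable N" "N \<subseteq> D" "norming_on r {x} N"
      using countable_norming_subset[OF r_norming, of x] r by auto
    then show ?thesis by blast
  qed
  then obtain N where N: "\<And>x. countable (N x)" "\<And>x. N x \<subseteq> D" "\<And>x. norming_on r {x} (N x)"
    by metis
  have \<Phi>: "countable (\<Phi> f)" if "f \<in> D" for f
    using generator that by (simp add: projectional_generator_def)
  \<comment> \<open>Closing off in the product handles both factors at once: the last two sets put \<open>N x\<close> into the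
    second projection and \<open>\<Phi> f\<close> into the first.\<close>
  define G where "G p q =
      (\<lambda>(c, d). scale c p + scale d q) ` (K \<times> K) \<union> {fst p} \<times> N (fst p) \<union> \<Phi> (snd p) \<times> {snd p}"
    for p q
  \<comment> \<open>The added zero keeps \<open>T\<close> nonempty even when \<open>C\<close> is
    empty.\<close>
  have "countable (insert 0 C)" "insert 0 C \<subseteq> UNIV \<times> D"
    using C D(4) by (auto simp: zero_prod_def)
  moreover have "countable (G p q) \<and> G p q \<subseteq> UNIV \<times> D" if "p \<in> UNIV \<times> D" "q \<in> UNIV \<times> D" for p q
    using that K N \<Phi> by (auto simp: G_def scale_def D.subspace_add[OF D(3)] D.subspace_scale[OF D(3)])
  ultimately obtain T where T: "countable T" "insert 0 C \<subseteq> T" "T \<subseteq> UNIV \<times> D"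
      and G: "\<And>p q. p \<in> T \<Longrightarrow> q \<in> T \<Longrightarrow> G p q \<subseteq> T"
    using countable_closed_superset[of "insert 0 C" "UNIV \<times> D" G] by metis
  define V Y where "V = closure (fst ` T)" and "Y = closure (snd ` T)"
  have ED: "snd ` T \<subseteq> D" using T(3) by auto
  have comb: "scale c p + scale d q \<in> T" if "p \<in> T" "q \<in> T" "c \<in> K" "d \<in> K" for c d p q
    using G[OF that(1,2)] that(3,4) by (auto simp: G_def)
  have "subspace V"
    unfolding V_def
  proof (rule subspace_closure_if_dense_scalars[OF K(4)])
    fix c d x y assume "c \<in> K" "d \<in> K" "x \<in> fst ` T" "y \<in> fst ` T"
    then obtain p q where "p \<in> T" "q \<in> T" "x = fst p" "y = fst q" by blast
    with comb[of p q c d] \<open>c \<in> K\<close> \<open>d \<in> K\<close> show "smul c x + smul d y \<in> fst ` T"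
      by (auto simp: scale_def image_iff intro: bexI[rotated])
  qed (use T(2) in auto)
  moreover have "D.subspace Y"
    unfolding Y_def
  proof (rule D.subspace_closure_if_dense_scalars[OF K(4)])
    fix c d x y assume "c \<in> K" "d \<in> K" "x \<in> snd ` T" "y \<in> snd ` T"
    then obtain p q where "p \<in> T" "q \<in> T" "x = snd p" "y = snd q" by blast
    with comb[of p q c d] \<open>c \<in> K\<close> \<open>d \<in> K\<close> show "dual_scale c x + dual_scale d y \<in> snd ` T"
      by (auto simp: scale_def image_iff intro: bexI[rotated])
  qed (use T(2) in auto)
  moreover have "Y \<subseteq> D" unfolding Y_def using ED D(2) by (rule closure_minimal)
  moreover have "norming_on r V Y"
  proof -
    have "norming_on r {fst p} Y" if p: "p \<in> T" for p
    proof -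
      have "{fst p} \<times> N (fst p) \<subseteq> T" using G[OF p p] by (simp add: G_def)
      then have "N (fst p) \<subseteq> snd ` T" by force
      then have "N (fst p) \<subseteq> Y" unfolding Y_def using closure_subset by blast
      then show ?thesis using N(3) norming_on_mono by blast
    qed
    then have "norming_on r (fst ` T) Y" by (force simp: norming_on_def)
    then show ?thesis unfolding V_def using r by (intro norming_on_closure) auto
  qed
  moreover have "(\<Union>e\<in>snd ` T. \<Phi> e) \<subseteq> V"
  proof -
    have "\<Phi> (snd p) \<subseteq> fst ` T" if p: "p \<in> T" for p
    proof -
      have "\<Phi> (snd p) \<times> {snd p} \<subseteq> T" using G[OF p p] by (simp add: G_def)
      then show ?thesis by force
    qed
    then show ?thesis unfolding V_def using closure_subset by blast
  qed
  ultimately have "admissible V Y"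
    using T(1) unfolding admissible_def mem_closed_separable_subspaces V_def Y_def
    by (metis closed_closure countable_image subset_UNIV)
  moreover have "C \<subseteq> V \<times> Y"
    unfolding V_def Y_def closure_Times[symmetric]
    using T(2) closure_subset[of "fst ` T \<times> snd ` T"] by force
  ultimately show ?thesis
    using that by (auto simp: admissible_rectangles_def)
qed

lemma admissible_rectangles_sides:
  assumes "w \<in> admissible_rectangles"
  shows "admissible (fst ` w) (snd ` w)" "w = fst ` w \<times> snd ` w"
proof -
  obtain V Y where w: "w = V \<times> Y" "admissible V Y"
    using assms by (auto simp: admissible_rectangles_def)
  then have "fst ` w = V" "snd ` w = Y" using admissible_zero by auto
  with w show "admissible (fst ` w) (snd ` w)" "w = fst ` w \<times> snd ` w" by auto
qed

lemma closure_Union_admissible_rectangles: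
  assumes s: "range s \<subseteq> admissible_rectangles" "incseq (s :: nat \<Rightarrow> _)"
  shows "admissible (closure (\<Union>i. fst ` s i)) (closure (\<Union>i. snd ` s i))" (is "admissible ?V ?Y")
    and "closure (\<Union>i. s i) = closure (\<Union>i. fst ` s i) \<times> closure (\<Union>i. snd ` s i)"
proof -
  have adm: "admissible (fst ` s i) (snd ` s i)" and prod: "s i = fst ` s i \<times> snd ` s i" for i
    using admissible_rectangles_sides s(1) by blast+
  have inc: "incseq (\<lambda>i. fst ` s i)" "incseq (\<lambda>i. snd ` s i)"
    using s(2) by (auto simp: incseq_def intro: image_mono)
  obtain E where E: "\<And>i. countable (E i)" "\<And>i. closure (E i) = snd ` s i"
      "\<And>i. (\<Union>e\<in>E i. \<Phi> e) \<subseteq> fst ` s i"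
    using adm unfolding admissible_def by metis
  have sub: "fst ` s i \<subseteq> ?V" "snd ` s i \<subseteq> ?Y" for i
    using closure_subset[of "\<Union>i. fst ` s i"] closure_subset[of "\<Union>i. snd ` s i"] by blast+
  have "norming_on r (fst ` s i) ?Y" for i
    using adm[of i] sub(2)[of i] norming_on_mono[of r "fst ` s i" "snd ` s i" "fst ` s i" ?Y]
    by (simp add: admissible_def)
  then have "norming_on r ?V ?Y"
    using r by (intro norming_on_closure norming_on_Union) auto
  moreover have "closure (\<Union>i. E i) = ?Y"
  proof (rule antisym)
    have "E i \<subseteq> snd ` s i" for i using E(2)[of i] closure_subset[of "E i"] by simp
    then show "closure (\<Union>i. E i) \<subseteq> ?Y" by (intro closure_mono UN_mono) auto
    have "snd ` s i \<subseteq> closure (\<Union>i. E i)" for i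
      unfolding E(2)[symmetric] by (intro closure_mono UN_upper) simp
    then show "?Y \<subseteq> closure (\<Union>i. E i)"
      by (intro closure_minimal UN_least) auto
  qed
  moreover have "(\<Union>e\<in>\<Union>i. E i. \<Phi> e) \<subseteq> ?V"
    using E(3) sub(1) by blast
  ultimately show "admissible ?V ?Y"
    unfolding admissible_def
    using adm inc E(1) D(2)
    by (auto simp: admissible_def scaled_banach_axioms D.scaled_banach_axioms
        intro!: closed_separable_subspaces_closure_incseq exI[of _ "\<Union>i. E i"])
  \<comment> \<open>Monotonicity makes the union a rectangle: coordinates coming from the stages
    \<open>i\<close> and \<open>j\<close> meet in stage \<open>max i j\<close>.\<close>
  have "(\<Union>i. s i) = (\<Union>i. fst ` s i) \<times> (\<Union>i. snd ` s i)"
  proof (intro equalityI subsetI)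
    fix p assume "p \<in> (\<Union>i. fst ` s i) \<times> (\<Union>i. snd ` s i)"
    then obtain i j where "fst p \<in> fst ` s i" "snd p \<in> snd ` s j"
      by (auto simp: mem_Times_iff)
    then have "fst p \<in> fst ` s (max i j)" "snd p \<in> snd ` s (max i j)"
      using incseqD[OF inc(1), of i "max i j"] incseqD[OF inc(2), of j "max i j"] by auto
    then have "p \<in> s (max i j)" by (subst prod) (simp add: mem_Times_iff)
    then show "p \<in> (\<Union>i. s i)" by blast
  qed (force simp: mem_Times_iff)
  then show "closure (\<Union>i. s i) = ?V \<times> ?Y" by (simp add: closure_Times)
qed

lemma closure_Union_in_admissible_rectangles:
  assumes "range s \<subseteq> admissible_rectangles" "incseq (s :: nat \<Rightarrow> _)"
  shows "closure (\<Union>i. s i) \<in> admissible_rectangles"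
  using closure_Union_admissible_rectangles[OF assms] by (auto simp: admissible_rectangles_def)

lemma admissible_rectangles_closed_separable:
  assumes "w \<in> admissible_rectangles"
  shows "w \<in> closed_separable_subspaces scale (UNIV \<times> D)"
proof -
  obtain V Y where w: "w = V \<times> Y" and "admissible V Y"
    using assms by (auto simp: admissible_rectangles_def)
  then obtain A B where VY: "subspace V" "closed V" "countable A" "closure A = V"
      "Y \<subseteq> D" "D.subspace Y" "closed Y" "countable B" "closure B = Y"
    by (auto simp: admissible_def mem_closed_separable_subspaces)
  then have "countable (A \<times> B) \<and> closure (A \<times> B) = w" by (simp add: w closure_Times)
  then show ?thesis
    using VY subspace_Times[of V Y]
    unfolding mem_closed_separable_subspaces w by (blast intro: closed_Times)
qed

lemma rich_admissible_rectangles: "rich scale (UNIV \<times> D) admissible_rectangles"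
  unfolding rich_def
proof (intro conjI ballI allI impI)
  show "admissible_rectangles \<subseteq> closed_separable_subspaces scale (UNIV \<times> D)"
    using admissible_rectangles_closed_separable by blast
next
  fix Z assume Z: "Z \<in> closed_separable_subspaces scale (UNIV \<times> D)"
  then obtain C where C: "countable C" "closure C = Z" "Z \<subseteq> UNIV \<times> D"
    by (auto simp: mem_closed_separable_subspaces)
  then obtain w where w: "w \<in> admissible_rectangles" "C \<subseteq> w"
    using admissible_rectangles_cofinal[of C] closure_subset by blast
  then have "Z \<subseteq> w"
    using C(2) admissible_rectangles_closed_separable
    by (auto simp: mem_closed_separable_subspaces dest: closure_minimal)
  with w show "\<exists>w\<in>admissible_rectangles. Z \<subseteq> w" by blast
qed (use closure_Union_in_admissible_rectangles in blast)

section \<open>The projectional skeleton indexed by the admissible rectangles\<close>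

text \<open>A linear projection is determined by its range and kernel, so the choice has only one
  candidate.\<close>

definition skeleton :: "('a \<times> ('a \<Rightarrow>\<^sub>L 'k)) set \<Rightarrow> 'a \<Rightarrow>\<^sub>L 'a" where
  "skeleton w = (SOME P. bounded_projection smul P \<and> norm P \<le> r \<and>
     range (blinfun_apply P) = fst ` w \<and> blinfun_apply P -` {0} = preannihilator (snd ` w) \<and>
     adjoint_range smul P = weak_star smul closure_of (snd ` w))"

lemma skeleton:
  assumes "w \<in> admissible_rectangles"
  shows "bounded_projection smul (skeleton w)" "norm (skeleton w) \<le> r"
    "range (blinfun_apply (skeleton w)) = fst ` w"
    "blinfun_apply (skeleton w) -` {0} = preannihilator (snd ` w)"
    "adjoint_range smul (skeleton w) = weak_star smul closure_of (snd ` w)"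
proof -
  have "\<exists>P. bounded_projection smul P \<and> norm P \<le> r \<and>
     range (blinfun_apply P) = fst ` w \<and> blinfun_apply P -` {0} = preannihilator (snd ` w) \<and>
     adjoint_range smul P = weak_star smul closure_of (snd ` w)"
    using admissible_projection[OF admissible_rectangles_sides(1)[OF assms]] by metis
  from someI_ex[OF this] show "bounded_projection smul (skeleton w)" "norm (skeleton w) \<le> r"
    "range (blinfun_apply (skeleton w)) = fst ` w"
    "blinfun_apply (skeleton w) -` {0} = preannihilator (snd ` w)"
    "adjoint_range smul (skeleton w) = weak_star smul closure_of (snd ` w)"
    unfolding skeleton_def by blast+
qed

lemma skeleton_fixes:
  assumes "w \<in> admissible_rectangles" "x \<in> fst ` w"
  shows "blinfun_apply (skeleton w) x = x"
proof -
  obtain y where "x = blinfun_apply (skeleton w) y"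
    using assms skeleton(3) by blast
  moreover have "skeleton w o\<^sub>L skeleton w = skeleton w"
    using skeleton(1)[OF assms(1)] by (simp add: bounded_projection_def)
  ultimately show ?thesis
    by (metis blinfun_apply_blinfun_compose)
qed

text \<open>Every upper bound in the family is a closed set, so containing the union means
  containing its closure.\<close>

lemma isLub_closure_Union:
  assumes "range s \<subseteq> admissible_rectangles" "incseq (s :: nat \<Rightarrow> _)"
  shows "isLub admissible_rectangles (range s) (closure (\<Union>i. s i))"
proof (rule isLubI2)
  show "isUb admissible_rectangles (range s) (closure (\<Union>i. s i))"
    using closure_Union_in_admissible_rectangles[OF assms] closure_subset[of "\<Union>i. s i"]
    by (auto intro!: isUbI setleI)
  have "closure (\<Union>i. s i) \<subseteq> w" if "isUb admissible_rectangles (range s) w" for w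
  proof (rule closure_minimal)
    show "(\<Union>i. s i) \<subseteq> w" using isUbD[OF that] by blast
    show "closed w"
      using admissible_rectangles_closed_separable[OF isUbD2a[OF that]]
      by (simp add: mem_closed_separable_subspaces)
  qed
  then show "closure (\<Union>i. s i) <=* Collect (isUb admissible_rectangles (range s))"
    by (intro setgeI) simp
qed

lemma projectional_skeleton_skeleton:
  "projectional_skeleton smul admissible_rectangles skeleton"
  unfolding projectional_skeleton_def
proof (intro conjI ballI allI impI)
  show "up_directed admissible_rectangles"
    unfolding up_directed_def
  proof (intro conjI ballI)
    show "admissible_rectangles \<noteq> {}"
      using admissible_rectangles_cofinal[of "{}"] by blast
    fix s t assume st: "s \<in> admissible_rectangles" "t \<in> admissible_rectangles"
    \<comment> \<open>Directedness is reduced to cofinality over the countable set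
      \<open>A \<union> B\<close>; a closed \<open>u\<close> above it contains both
      rectangles.\<close>
    then obtain A B where "countable A" "closure A = s" "countable B" "closure B = t"
        "s \<subseteq> UNIV \<times> D" "t \<subseteq> UNIV \<times> D"
      using admissible_rectangles_closed_separable
      unfolding mem_closed_separable_subspaces by meson
    then have "countable (A \<union> B)" "A \<union> B \<subseteq> UNIV \<times> D" "closure (A \<union> B) = s \<union> t"
      using closure_subset[of A] closure_subset[of B] by (auto simp: closure_Un)
    moreover from this obtain u where u: "u \<in> admissible_rectangles" "A \<union> B \<subseteq> u"
      using admissible_rectangles_cofinal[of "A \<union> B"] by blast
    moreover from u have "closed u"
      using admissible_rectangles_closed_separable by (simp add: mem_closed_separable_subspaces)
    ultimately show "\<exists>u\<in>admissible_rectangles. s \<le> u \<and> t \<le> u"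
      using closure_minimal[of "A \<union> B" u] by auto
  qed
  show "sigma_complete admissible_rectangles"
    unfolding sigma_complete_def using isLub_closure_Union by blast
next
  fix s assume s: "s \<in> admissible_rectangles"
  show "bounded_projection smul (skeleton s)" using s by (rule skeleton)
  show "separable_space (top_of_set (range (blinfun_apply (skeleton s))))"
    using admissible_rectangles_sides(1)[OF s]
    by (simp add: skeleton(3)[OF s] admissible_def closed_separable_subspaces_def)
next
  have "x \<in> (\<Union>s\<in>admissible_rectangles. range (blinfun_apply (skeleton s)))" for x
  proof -
    obtain w where "w \<in> admissible_rectangles" "{(x, 0)} \<subseteq> w"
      using admissible_rectangles_cofinal[of "{(x, 0)}"] D(4) by auto
    then show ?thesis using skeleton(3) by force
  qed
  then show "(\<Union>s\<in>admissible_rectangles. range (blinfun_apply (skeleton s))) = UNIV" by blast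
next
  fix s t assume st: "s \<in> admissible_rectangles" "t \<in> admissible_rectangles" "s \<le> t"
  show "skeleton t o\<^sub>L skeleton s = skeleton s"
  proof (rule blinfun_eqI)
    fix x
    have "blinfun_apply (skeleton s) x \<in> fst ` t"
      using st(3) skeleton(3)[OF st(1)] by blast
    then show "blinfun_apply (skeleton t o\<^sub>L skeleton s) x = blinfun_apply (skeleton s) x"
      by (simp add: skeleton_fixes[OF st(2)])
  qed
  \<comment> \<open>Preannihilators reverse inclusion: enlarging \<open>s\<close> to
    \<open>t\<close> shrinks the kernel, so \<open>x\<close> minus its image under
    \<open>skeleton t\<close> is killed by \<open>skeleton s\<close> too.\<close>
  show "skeleton s o\<^sub>L skeleton t = skeleton s"
  proof (rule blinfun_eqI)
    fix x
    have "blinfun_apply (skeleton t) x \<in> fst ` t"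
      using skeleton(3)[OF st(2)] by blast
    then have "x - blinfun_apply (skeleton t) x \<in> blinfun_apply (skeleton t) -` {0}"
      by (simp add: blinfun.diff_right skeleton_fixes[OF st(2)])
    then have "x - blinfun_apply (skeleton t) x \<in> preannihilator (snd ` s)"
      using st(3) unfolding skeleton(4)[OF st(2)] preannihilator_def by blast
    then have "blinfun_apply (skeleton s) (x - blinfun_apply (skeleton t) x) = 0"
      using skeleton(4)[OF st(1)] by blast
    then show "blinfun_apply (skeleton s o\<^sub>L skeleton t) x = blinfun_apply (skeleton s) x"
      by (simp add: blinfun.diff_right)
  qed
next
  fix s :: "nat \<Rightarrow> _" and t
  assume s: "range s \<subseteq> admissible_rectangles" "strict_mono s"
    and t: "isLub admissible_rectangles (range s) t"
  have inc: "incseq s" using s(2) strict_mono_mono by blast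
  \<comment> \<open>Suprema are unique, so \<open>t\<close> is the closure of the union, and its
    first side can be read off from the product form.\<close>
  have "t = closure (\<Union>i. s i)"
    using isLub_le_isUb isLub_isUb t isLub_closure_Union[OF s(1) inc] by (metis order_antisym)
  then have "t = closure (\<Union>i. fst ` s i) \<times> closure (\<Union>i. snd ` s i)"
    using closure_Union_admissible_rectangles(2)[OF s(1) inc] by simp
  moreover have "0 \<in> closure (\<Union>i. snd ` s i)"
    using admissible_zero[OF closure_Union_admissible_rectangles(1)[OF s(1) inc]] by (rule conjunct2)
  ultimately have "fst ` t = closure (\<Union>i. fst ` s i)"
    by (simp only: fst_image_times) auto
  moreover have "s n \<in> admissible_rectangles" for n using s(1) by blast
  ultimately show "range (blinfun_apply (skeleton t))
      = closure (\<Union>n. range (blinfun_apply (skeleton (s n))))"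
    using isLubD1a[OF t] by (simp add: skeleton(3))
qed

text \<open>A rectangle containing \<open>(0, f)\<close> has \<open>f\<close> in its second side,
  hence in the weak* closure of that side.\<close>

lemma D_subset_adjoint_ranges:
  "D \<subseteq> (\<Union>\<gamma>\<in>admissible_rectangles. adjoint_range smul (skeleton \<gamma>))"
proof
  fix f assume f: "f \<in> D"
  then obtain w where w: "w \<in> admissible_rectangles" "{(0, f)} \<subseteq> w"
    using admissible_rectangles_cofinal[of "{(0, f)}"] by auto
  have "snd ` w \<subseteq> D"
    using admissible_rectangles_sides(1)[OF w(1)]
    by (auto simp: admissible_def mem_closed_separable_subspaces)
  then have "snd ` w \<subseteq> weak_star smul closure_of (snd ` w)"
    using D(1) by (intro closure_of_subset) (auto simp: weak_star_def topspace_pullback_topology)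
  then have "f \<in> weak_star smul closure_of (snd ` w)"
    using w(2) by force
  then show "f \<in> (\<Union>\<gamma>\<in>admissible_rectangles. adjoint_range smul (skeleton \<gamma>))"
    using w(1) skeleton(5) by blast
qed

end

theorem proposition10:
  fixes smul :: "'k::real_or_complex \<Rightarrow> 'a::banach \<Rightarrow> 'a"
    and D :: "('a \<Rightarrow>\<^sub>L 'k) set"
    and \<Phi> :: "('a \<Rightarrow>\<^sub>L 'k) \<Rightarrow> 'a set"
    and r :: real
  assumes "scaled_banach smul"
    and "projectional_generator smul D \<Phi>"
    and "r \<ge> 1" and "r_norming smul r D"
  shows "\<exists>W. W \<subseteq> rectangles smul D \<and>
             rich (prod_scale smul) (UNIV \<times> D) W \<and>
             (\<exists>Q :: ('a \<times> ('a \<Rightarrow>\<^sub>L 'k)) set \<Rightarrow> 'a \<Rightarrow>\<^sub>L 'a.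
                (\<forall>V Y. V \<times> Y \<in> W \<longrightarrow>
                   bounded_projection smul (Q (V \<times> Y)) \<and>
                   norm (Q (V \<times> Y)) \<le> r \<and>
                   range (blinfun_apply (Q (V \<times> Y))) = V \<and>
                   blinfun_apply (Q (V \<times> Y)) -` {0} = preannihilator Y \<and>
                   adjoint_range smul (Q (V \<times> Y)) = weak_star smul closure_of Y) \<and>
                r_projectional_skeleton smul r W Q \<and>
                D \<subseteq> (\<Union>\<gamma>\<in>W. adjoint_range smul (Q \<gamma>)))"
proof -
  interpret projectional_generator_space smul D \<Phi> r
    using assms by (intro projectional_generator_space.intro projectional_generator_space_axioms.intro)
  \<comment> \<open>\<open>skeleton\<close> is described through projections of the index; nonempty
    sides translate this to a given \<open>V\<close> and \<open>Y\<close>.\<close>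
  have "fst ` (V \<times> Y) = V \<and> snd ` (V \<times> Y) = Y" if "V \<times> Y \<in> admissible_rectangles" for V Y
    using admissible_zero[OF admissible_rectangles_sides(1)[OF that]] by auto
  then have "\<forall>V Y. V \<times> Y \<in> admissible_rectangles \<longrightarrow>
      bounded_projection smul (skeleton (V \<times> Y)) \<and> norm (skeleton (V \<times> Y)) \<le> r \<and>
      range (blinfun_apply (skeleton (V \<times> Y))) = V \<and>
      blinfun_apply (skeleton (V \<times> Y)) -` {0} = preannihilator Y \<and>
      adjoint_range smul (skeleton (V \<times> Y)) = weak_star smul closure_of Y"
    using skeleton by metis
  moreover have "r_projectional_skeleton smul r admissible_rectangles skeleton"
    using projectional_skeleton_skeleton skeleton(2) by (simp add: r_projectional_skeleton_def)
  moreover have "admissible_rectangles \<subseteq> rectangles smul D"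
    by (auto simp: admissible_rectangles_def rectangles_def admissible_def)
  ultimately show ?thesis
    using rich_admissible_rectangles D_subset_adjoint_ranges by blast
qed

end
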